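(* Let $R$ be a ring. (a) Every almost projective $R$-module $M_0$ can be represented as $M/L$, where $M$ is a Tate $R$-module and $L\subset M$ is a bounded open submodule. (b) If $M_0$ is 2-almost projective, then in such a representation $L$ is a lattice.
   Context: An $R$-module is almost projective if it is a direct summand of a module of the form $P\oplus F$ with $P$ projective and $F$ finitely generated; it is 2-almost projective if it is a direct summand of $P\oplus F$ with $P$ projective and $F$ of finite presentation. A Tate $R$-module is a topological direct summand of $P\oplus Q^*$ with $P$ a discrete projective left $R$-module, $Q$ a discrete projective right $R$-module and $Q^*=\operatorname{Hom}_R(Q,R)$ with topology of pointwise convergence. A lattice in a Tate module $M$ is an open submodule $L$ such that $L/U$ is finitely generated for every open submodule $U\subset L$; a subset of $M$ is bounded if it is contained in some lattice. *)

theory Defs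
  imports "HOL-Analysis.Analysis"
begin

text \<open>The ring R is the (possibly noncommutative) ring with unit given by a type of class ring_1.
  A module is a record: carrier, addition, zero, scalar action.  For a LEFT module
  smul r x means r x; for a RIGHT module smul r x means x r.\<close>

record ('r, 'a) lmod =
  carr :: "'a set"
  add  :: "'a \<Rightarrow> 'a \<Rightarrow> 'a"
  zer  :: "'a"
  smul :: "'r \<Rightarrow> 'a \<Rightarrow> 'a"

definition abgrp_part :: "('r, 'a) lmod \<Rightarrow> bool" where
  "abgrp_part M \<longleftrightarrow>
     zer M \<in> carr M \<and>
     (\<forall>x\<in>carr M. \<forall>y\<in>carr M. add M x y \<in> carr M) \<and>
     (\<forall>x\<in>carr M. \<forall>y\<in>carr M. \<forall>z\<in>carr M. add M (add M x y) z = add M x (add M y z)) \<and>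
     (\<forall>x\<in>carr M. \<forall>y\<in>carr M. add M x y = add M y x) \<and>
     (\<forall>x\<in>carr M. add M (zer M) x = x) \<and>
     (\<forall>x\<in>carr M. \<exists>y\<in>carr M. add M x y = zer M)"

definition lmodule :: "('r::ring_1, 'a) lmod \<Rightarrow> bool" where
  "lmodule M \<longleftrightarrow> abgrp_part M \<and>
     (\<forall>r. \<forall>x\<in>carr M. smul M r x \<in> carr M) \<and>
     (\<forall>r. \<forall>x\<in>carr M. \<forall>y\<in>carr M. smul M r (add M x y) = add M (smul M r x) (smul M r y)) \<and>
     (\<forall>r s. \<forall>x\<in>carr M. smul M (r + s) x = add M (smul M r x) (smul M s x)) \<and>
     (\<forall>r s. \<forall>x\<in>carr M. smul M (r * s) x = smul M r (smul M s x)) \<and>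
     (\<forall>x\<in>carr M. smul M 1 x = x)"

text \<open>Right module: smul r x stands for x r, so x (r s) = (x r) s.\<close>
definition rmodule :: "('r::ring_1, 'a) lmod \<Rightarrow> bool" where
  "rmodule M \<longleftrightarrow> abgrp_part M \<and>
     (\<forall>r. \<forall>x\<in>carr M. smul M r x \<in> carr M) \<and>
     (\<forall>r. \<forall>x\<in>carr M. \<forall>y\<in>carr M. smul M r (add M x y) = add M (smul M r x) (smul M r y)) \<and>
     (\<forall>r s. \<forall>x\<in>carr M. smul M (r + s) x = add M (smul M r x) (smul M s x)) \<and>
     (\<forall>r s. \<forall>x\<in>carr M. smul M (r * s) x = smul M s (smul M r x)) \<and>
     (\<forall>x\<in>carr M. smul M 1 x = x)"

definition mhom :: "('r, 'a) lmod \<Rightarrow> ('r, 'b) lmod \<Rightarrow> ('a \<Rightarrow> 'b) \<Rightarrow> bool" where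
  "mhom M N f \<longleftrightarrow>
     (\<forall>x\<in>carr M. f x \<in> carr N) \<and>
     (\<forall>x\<in>carr M. \<forall>y\<in>carr M. f (add M x y) = add N (f x) (f y)) \<and>
     (\<forall>r. \<forall>x\<in>carr M. f (smul M r x) = smul N r (f x))"

definition submodule :: "'a set \<Rightarrow> ('r, 'a) lmod \<Rightarrow> bool" where
  "submodule S M \<longleftrightarrow> S \<subseteq> carr M \<and> zer M \<in> S \<and>
     (\<forall>x\<in>S. \<forall>y\<in>S. add M x y \<in> S) \<and> (\<forall>r. \<forall>x\<in>S. smul M r x \<in> S)"

definition span :: "('r, 'a) lmod \<Rightarrow> 'a set \<Rightarrow> 'a set" where
  "span M S = \<Inter>{T. submodule T M \<and> S \<subseteq> T}"

definition fin_gen :: "('r, 'a) lmod \<Rightarrow> bool" where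
  "fin_gen M \<longleftrightarrow> (\<exists>S. finite S \<and> S \<subseteq> carr M \<and> span M S = carr M)"

definition dsum :: "('r, 'a) lmod \<Rightarrow> ('r, 'b) lmod \<Rightarrow> ('r, 'a \<times> 'b) lmod" where
  "dsum M N = \<lparr> carr = carr M \<times> carr N,
                add = (\<lambda>(x1, y1) (x2, y2). (add M x1 x2, add N y1 y2)),
                zer = (zer M, zer N),
                smul = (\<lambda>r (x, y). (smul M r x, smul N r y)) \<rparr>"

definition summand :: "('r, 'a) lmod \<Rightarrow> ('r, 'b) lmod \<Rightarrow> bool" where
  "summand M X \<longleftrightarrow> (\<exists>i p. mhom M X i \<and> mhom X M p \<and> (\<forall>x\<in>carr M. p (i x) = x))"

definition free_lmod :: "'i set \<Rightarrow> ('r::ring_1, 'i \<Rightarrow> 'r) lmod" where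
  "free_lmod I = \<lparr> carr = {f. finite {i. f i \<noteq> 0} \<and> (\<forall>i. i \<notin> I \<longrightarrow> f i = 0)},
                   add = (\<lambda>f g i. f i + g i), zer = (\<lambda>i. 0),
                   smul = (\<lambda>r f i. r * f i) \<rparr>"

definition free_rmod :: "'i set \<Rightarrow> ('r::ring_1, 'i \<Rightarrow> 'r) lmod" where
  "free_rmod I = \<lparr> carr = {f. finite {i. f i \<noteq> 0} \<and> (\<forall>i. i \<notin> I \<longrightarrow> f i = 0)},
                   add = (\<lambda>f g i. f i + g i), zer = (\<lambda>i. 0),
                   smul = (\<lambda>r f i. f i * r) \<rparr>"

text \<open>Projective = direct summand of a free module (free on the elements of the module,
  which is no loss of generality).\<close>
definition lprojective :: "('r::ring_1, 'a) lmod \<Rightarrow> bool" where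
  "lprojective P \<longleftrightarrow> lmodule P \<and> summand P (free_lmod (carr P))"

definition rprojective :: "('r::ring_1, 'a) lmod \<Rightarrow> bool" where
  "rprojective Q \<longleftrightarrow> rmodule Q \<and> summand Q (free_rmod (carr Q))"

definition fin_pres :: "('r::ring_1, 'a) lmod \<Rightarrow> bool" where
  "fin_pres F \<longleftrightarrow> lmodule F \<and>
     (\<exists>(n::nat) f. mhom (free_lmod {..<n}) F f \<and> f ` carr (free_lmod {..<n}) = carr F \<and>
        (\<exists>S. finite S \<and> S \<subseteq> carr (free_lmod {..<n}) \<and>
             span (free_lmod {..<n}) S = {x \<in> carr (free_lmod {..<n}). f x = zer F}))"

definition ring_rmod :: "('r::ring_1, 'r) lmod" where
  "ring_rmod = \<lparr> carr = UNIV, add = (+), zer = 0, smul = (\<lambda>r x. x * r) \<rparr>"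

text \<open>Q* = Hom_R(Q, R) for a right module Q, a left module via (r phi)(q) = r phi(q).
  Elements are extensional functions on carr Q (value undefined outside).\<close>
definition dual :: "('r::ring_1, 'q) lmod \<Rightarrow> ('r, 'q \<Rightarrow> 'r) lmod" where
  "dual Q = \<lparr> carr = {\<phi>. \<phi> \<in> extensional (carr Q) \<and> mhom Q ring_rmod \<phi>},
              add = (\<lambda>\<phi> \<psi>. restrict (\<lambda>x. \<phi> x + \<psi> x) (carr Q)),
              zer = restrict (\<lambda>x. 0) (carr Q),
              smul = (\<lambda>r \<phi>. restrict (\<lambda>x. r * \<phi> x) (carr Q)) \<rparr>"

definition dual_top :: "('r::ring_1, 'q) lmod \<Rightarrow> ('q \<Rightarrow> 'r) topology" where
  "dual_top Q = subtopology (product_topology (\<lambda>_. discrete_topology UNIV) (carr Q)) (carr (dual Q))"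

definition tate :: "'p itself \<Rightarrow> 'q itself \<Rightarrow> ('r::ring_1, 'm) lmod \<Rightarrow> 'm topology \<Rightarrow> bool" where
  "tate _ _ M \<tau> \<longleftrightarrow> lmodule M \<and> topspace \<tau> = carr M \<and>
     (\<exists>(P::('r, 'p) lmod) (Q::('r, 'q) lmod) i p.
        lprojective P \<and> rprojective Q \<and>
        mhom M (dsum P (dual Q)) i \<and> mhom (dsum P (dual Q)) M p \<and>
        continuous_map \<tau> (prod_topology (discrete_topology (carr P)) (dual_top Q)) i \<and>
        continuous_map (prod_topology (discrete_topology (carr P)) (dual_top Q)) \<tau> p \<and>
        (\<forall>x\<in>carr M. p (i x) = x))"

definition lattice_in :: "('r, 'm) lmod \<Rightarrow> 'm topology \<Rightarrow> 'm set \<Rightarrow> bool" where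
  "lattice_in M \<tau> L \<longleftrightarrow> submodule L M \<and> openin \<tau> L \<and>
     (\<forall>U. submodule U M \<and> openin \<tau> U \<and> U \<subseteq> L \<longrightarrow>
        (\<exists>S. finite S \<and> S \<subseteq> L \<and> span M (S \<union> U) = L))"

definition bounded_in :: "('r, 'm) lmod \<Rightarrow> 'm topology \<Rightarrow> 'm set \<Rightarrow> bool" where
  "bounded_in M \<tau> B \<longleftrightarrow> (\<exists>L. lattice_in M \<tau> L \<and> B \<subseteq> L)"

definition almost_projective :: "'p itself \<Rightarrow> 'f itself \<Rightarrow> ('r::ring_1, 'a) lmod \<Rightarrow> bool" where
  "almost_projective _ _ M0 \<longleftrightarrow> lmodule M0 \<and>
     (\<exists>(P::('r, 'p) lmod) (F::('r, 'f) lmod).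
        lprojective P \<and> lmodule F \<and> fin_gen F \<and> summand M0 (dsum P F))"

definition almost_projective2 :: "'p itself \<Rightarrow> 'f itself \<Rightarrow> ('r::ring_1, 'a) lmod \<Rightarrow> bool" where
  "almost_projective2 _ _ M0 \<longleftrightarrow> lmodule M0 \<and>
     (\<exists>(P::('r, 'p) lmod) (F::('r, 'f) lmod).
        lprojective P \<and> fin_pres F \<and> summand M0 (dsum P F))"

definition quotient_rep :: "('r, 'm) lmod \<Rightarrow> 'm set \<Rightarrow> ('r, 'a) lmod \<Rightarrow> bool" where
  "quotient_rep M L M0 \<longleftrightarrow> (\<exists>f. mhom M M0 f \<and> f ` carr M = carr M0 \<and>
                               {x \<in> carr M. f x = zer M0} = L)"

end

theory Submission
  imports Defs "HOL-Algebra.FiniteProduct" "HOL-Library.Function_Algebras"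
begin

text \<open>
  (b) Let \<open>q : M \<rightarrow> M0\<close> have kernel \<open>L\<close>, let \<open>M0\<close> be a summand of \<open>P0 \<oplus> F\<close>, and let
  \<open>\<pi> : P2 \<rightarrow> P0 \<oplus> F\<close> be an epimorphism from a projective module with finitely generated kernel \<open>E\<close>.
  Modulo \<open>L\<close> the identity of \<open>M\<close> factors through a discrete projective module, so lifting gives an
  endomorphism \<open>\<theta>\<close> of \<open>M\<close> with open kernel that factors through \<open>P2\<close>, satisfies \<open>q \<theta> = q\<close> and maps \<open>L\<close>
  into the image of \<open>E\<close>.  As \<open>1 - \<theta>\<close> maps a lattice containing \<open>L\<close> into \<open>L\<close>, the module \<open>L\<close> is finitely
  generated modulo every open submodule.

  (a) Lifting the idempotent that cuts out \<open>M0\<close>, one finds a free module \<open>P\<close>, a finitely generated free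
  summand \<open>C\<close>, an epimorphism \<open>q : P \<rightarrow> M0\<close> and an endomorphism \<open>\<epsilon>\<close> of \<open>P\<close> with \<open>q \<epsilon> = q\<close> and
  \<open>\<epsilon> (ker q) \<subseteq> C\<close>; in particular \<open>\<epsilon> - \<epsilon>\<^sup>2\<close> maps \<open>P\<close> into \<open>C\<close>.  Take for \<open>M\<close> the module of all sequences
  \<open>(x\<^sub>k)\<close> in \<open>P\<close> with \<open>(1 - \<epsilon>) x\<^sub>k + \<epsilon> x\<^sub>k\<^sub>+\<^sub>1 \<in> C\<close> for all \<open>k\<close>, mapped onto \<open>M0\<close> by \<open>x \<mapsto> q x\<^sub>0\<close>.  A sequence
  is recovered from \<open>\<epsilon> x\<^sub>0\<close> and the elements \<open>(\<epsilon> - \<epsilon>\<^sup>2) x\<^sub>k\<close> and \<open>(1 - \<epsilon>) x\<^sub>k + \<epsilon> x\<^sub>k\<^sub>+\<^sub>1\<close> of \<open>C\<close>, which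
  exhibits \<open>M\<close> as a summand of \<open>P \<oplus> Q*\<close> with \<open>Q\<close> free, and the kernel lies in the image of the lattice
  \<open>C \<oplus> Q*\<close>.
\<close>

section \<open>Modules and free modules\<close>

lemma lmodule_D:
  assumes "lmodule M"
  shows "zer M \<in> carr M"
    and "x \<in> carr M \<Longrightarrow> y \<in> carr M \<Longrightarrow> add M x y \<in> carr M"
    and "x \<in> carr M \<Longrightarrow> y \<in> carr M \<Longrightarrow> z \<in> carr M \<Longrightarrow> add M (add M x y) z = add M x (add M y z)"
    and "x \<in> carr M \<Longrightarrow> y \<in> carr M \<Longrightarrow> add M x y = add M y x"
    and "x \<in> carr M \<Longrightarrow> add M (zer M) x = x"
    and "x \<in> carr M \<Longrightarrow> smul M r x \<in> carr M"
    and "x \<in> carr M \<Longrightarrow> y \<in> carr M \<Longrightarrow> smul M r (add M x y) = add M (smul M r x) (smul M r y)"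
    and "x \<in> carr M \<Longrightarrow> smul M (r + s) x = add M (smul M r x) (smul M s x)"
    and "x \<in> carr M \<Longrightarrow> smul M (r * s) x = smul M r (smul M s x)"
    and "x \<in> carr M \<Longrightarrow> smul M 1 x = x"
  by (use assms in \<open>unfold lmodule_def abgrp_part_def, (elim conjE, blast)+\<close>)

text \<open>Gives access to \<open>finprod\<close>, which serves as the finite sum in a module whose
  carrier is a set rather than a type.\<close>

lemma abgrp_part_comm_monoid:
  assumes "abgrp_part N"
  shows "comm_monoid \<lparr>carrier = carr N, mult = add N, one = zer N\<rparr>"
  using assms unfolding abgrp_part_def by (intro comm_monoidI) auto

lemma abgrp_part_cancel:
  assumes "abgrp_part N" "x \<in> carr N" "add N x x = x"
  shows "x = zer N"
proof -
  obtain y where y: "y \<in> carr N" "add N x y = zer N"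
    using assms unfolding abgrp_part_def by blast
  have "add N (add N x x) y = add N x (add N x y)"
    using assms(1,2) y unfolding abgrp_part_def by blast
  then have "zer N = add N x (zer N)" using y assms(3) by simp
  also have "\<dots> = add N (zer N) x" using assms(1,2) unfolding abgrp_part_def by blast
  also have "\<dots> = x" using assms(1,2) unfolding abgrp_part_def by blast
  finally show ?thesis by simp
qed

text \<open>Left and right modules are treated together: \<open>\<mu>\<close> is the multiplication of the ring or
  its opposite.\<close>

definition gmodule :: "('r \<Rightarrow> 'r \<Rightarrow> 'r) \<Rightarrow> ('r::ring_1, 'a) lmod \<Rightarrow> bool" where
  "gmodule \<mu> M \<longleftrightarrow> abgrp_part M \<and>
     (\<forall>r. \<forall>x\<in>carr M. smul M r x \<in> carr M) \<and>
     (\<forall>r. \<forall>x\<in>carr M. \<forall>y\<in>carr M. smul M r (add M x y) = add M (smul M r x) (smul M r y)) \<and>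
     (\<forall>r s. \<forall>x\<in>carr M. smul M (r + s) x = add M (smul M r x) (smul M s x)) \<and>
     (\<forall>r s. \<forall>x\<in>carr M. smul M (\<mu> r s) x = smul M r (smul M s x)) \<and>
     (\<forall>x\<in>carr M. smul M 1 x = x)"

definition gfree :: "('r \<Rightarrow> 'r \<Rightarrow> 'r) \<Rightarrow> 'i set \<Rightarrow> ('r::ring_1, 'i \<Rightarrow> 'r) lmod" where
  "gfree \<mu> I = \<lparr> carr = {f. finite {i. f i \<noteq> 0} \<and> (\<forall>i. i \<notin> I \<longrightarrow> f i = 0)},
                   add = (\<lambda>f g i. f i + g i), zer = (\<lambda>i. 0),
                   smul = (\<lambda>r f i. \<mu> r (f i)) \<rparr>"

definition ring_or_opp :: "('r::ring_1 \<Rightarrow> 'r \<Rightarrow> 'r) \<Rightarrow> bool" where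
  "ring_or_opp \<mu> \<longleftrightarrow> \<mu> = (*) \<or> \<mu> = (\<lambda>r s. s * r)"

lemma ring_or_opp_mult [simp]: "ring_or_opp (*)" "ring_or_opp (\<lambda>r s. s * r)"
  by (simp_all add: ring_or_opp_def)

lemma lmodule_gmodule: "lmodule M = gmodule (*) M"
  by (simp add: lmodule_def gmodule_def)

lemma rmodule_gmodule: "rmodule M = gmodule (\<lambda>r s. s * r) M"
  unfolding rmodule_def gmodule_def by blast

lemma free_lmod_gfree: "free_lmod = gfree (*)"
  by (simp add: fun_eq_iff free_lmod_def gfree_def)

lemma free_rmod_gfree: "free_rmod = gfree (\<lambda>r s. s * r)"
  by (simp add: fun_eq_iff free_rmod_def gfree_def)

definition delta :: "'i \<Rightarrow> 'i \<Rightarrow> 'r::ring_1" where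
  "delta i = (\<lambda>j. if j = i then 1 else 0)"

lemma delta_simps [simp]: "delta i i = 1" "j \<noteq> i \<Longrightarrow> delta i j = 0"
  by (simp_all add: delta_def)

lemma delta_in_gfree [simp]: "i \<in> I \<Longrightarrow> delta i \<in> carr (gfree \<mu> I)"
  by (auto simp: gfree_def delta_def)

lemma gmodule_gfree:
  fixes \<mu> :: "'r::ring_1 \<Rightarrow> 'r \<Rightarrow> 'r"
  assumes "ring_or_opp \<mu>"
  shows "gmodule \<mu> (gfree \<mu> (I :: 'i set))"
proof -
  have fin: "finite {i. h (f i) (g i) \<noteq> 0}" if "finite {i. f i \<noteq> 0}" "finite {i. g i \<noteq> 0}" "h 0 0 = 0"
    for f g :: "'i \<Rightarrow> 'r" and h :: "'r \<Rightarrow> 'r \<Rightarrow> 'r"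
    by (rule finite_subset[of _ "{i. f i \<noteq> 0} \<union> {i. g i \<noteq> 0}"]) (use that in auto)
  have fin1: "finite {i. h (f i) \<noteq> 0}" if "finite {i. f i \<noteq> 0}" "h 0 = 0"
    for f :: "'i \<Rightarrow> 'r" and h :: "'r \<Rightarrow> 'r"
    by (rule finite_subset[of _ "{i. f i \<noteq> 0}"]) (use that in auto)
  have inv: "\<exists>y\<in>carr (gfree \<mu> I). add (gfree \<mu> I) x y = zer (gfree \<mu> I)"
    if "x \<in> carr (gfree \<mu> I)" for x
    by (rule bexI[of _ "\<lambda>i. - x i"]) (use that in \<open>auto simp: gfree_def\<close>)
  have closed: "add (gfree \<mu> I) x y \<in> carr (gfree \<mu> I)"
    if "x \<in> carr (gfree \<mu> I)" "y \<in> carr (gfree \<mu> I)" for x y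
    using that fin[of x y "(+)"] by (simp add: gfree_def)
  have sclosed: "smul (gfree \<mu> I) r x \<in> carr (gfree \<mu> I)" if "x \<in> carr (gfree \<mu> I)" for r x
    using that fin1[of x "\<mu> r"] assms by (auto simp: gfree_def ring_or_opp_def)
  have group: "abgrp_part (gfree \<mu> I)"
    unfolding abgrp_part_def using closed inv
    by (intro conjI ballI) (simp_all add: gfree_def algebra_simps)
  show ?thesis
    using assms unfolding gmodule_def ring_or_opp_def using group sclosed
    by (intro conjI ballI allI) (auto simp: gfree_def algebra_simps)
qed

lemma lmodule_free_lmod: "lmodule (free_lmod I)"
  by (simp add: lmodule_gmodule free_lmod_gfree gmodule_gfree)

text \<open>Induction on a finite set containing the support of \<open>x\<close>; each step splits
  off one coordinate as a multiple of the basis vector \<open>delta a\<close>.\<close>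

lemma gfree_induct:
  assumes mu: "ring_or_opp \<mu>" and x: "x \<in> carr (gfree \<mu> I)"
    and zero: "Q (\<lambda>i. 0)"
    and delta: "\<And>i r. i \<in> I \<Longrightarrow> Q (smul (gfree \<mu> I) r (delta i))"
    and add: "\<And>y z. y \<in> carr (gfree \<mu> I) \<Longrightarrow> z \<in> carr (gfree \<mu> I) \<Longrightarrow> Q y \<Longrightarrow> Q z \<Longrightarrow> Q (add (gfree \<mu> I) y z)"
  shows "Q x"
proof -
  have "\<forall>x\<in>carr (gfree \<mu> I). {i. x i \<noteq> 0} \<subseteq> A \<longrightarrow> Q x" if "finite A" for A
    using that
  proof (induction A rule: finite_induct)
    case empty
    then show ?case using zero by (auto simp: fun_eq_iff dest!: ext)
  next
    case (insert a A)
    show ?case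
    proof (intro ballI impI)
      fix x assume x: "x \<in> carr (gfree \<mu> I)" and s: "{i. x i \<noteq> 0} \<subseteq> insert a A"
      show "Q x"
      proof (cases "a \<in> I")
        case False
        then have "{i. x i \<noteq> 0} \<subseteq> A" using x s by (auto simp: gfree_def)
        then show ?thesis using insert.IH x by blast
      next
        case True
        let ?y = "x(a := 0)"
        have fy: "finite {i. ?y i \<noteq> 0}"
          by (rule finite_subset[of _ "{i. x i \<noteq> 0}"]) (use x in \<open>auto simp: gfree_def\<close>)
        have y: "?y \<in> carr (gfree \<mu> I)" using x fy by (auto simp: gfree_def)
        have "{i. ?y i \<noteq> 0} \<subseteq> A" using s by auto
        then have Qy: "Q ?y" using insert.IH y by blast
        let ?z = "smul (gfree \<mu> I) (x a) (delta a)"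
        have z: "?z \<in> carr (gfree \<mu> I)"
          using gmodule_gfree[OF mu, of I] delta_in_gfree[OF True, of \<mu>] by (simp add: gmodule_def)
        have "x = add (gfree \<mu> I) ?z ?y"
          using mu by (auto simp: gfree_def fun_eq_iff ring_or_opp_def delta_def)
        then show ?thesis using add[OF z y delta[OF True] Qy] by simp
      qed
    qed
  qed
  moreover have "finite {i. x i \<noteq> 0}" using x by (simp add: gfree_def)
  ultimately show ?thesis using x by blast
qed

text \<open>The homomorphism is the linear combination of the \<open>g i\<close> with the
  coordinates of \<open>x\<close> as coefficients, taken over the support of
  \<open>x\<close>.\<close>

lemma gfree_universal:
  fixes N :: "('r::ring_1, 'a) lmod"
  assumes mu: "ring_or_opp \<mu>" and N: "gmodule \<mu> N" and g: "\<And>i. i \<in> I \<Longrightarrow> g i \<in> carr N"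
  shows "\<exists>f. mhom (gfree \<mu> I) N f \<and> (\<forall>i\<in>I. f (delta i) = g i)"
proof -
  let ?G = "\<lparr>carrier = carr N, mult = add N, one = zer N\<rparr>"
  interpret comm_monoid ?G
    by (rule abgrp_part_comm_monoid) (use N in \<open>simp add: gmodule_def\<close>)
  have ab: "abgrp_part N" using N by (simp add: gmodule_def)
  have cl: "smul N r x \<in> carr N" if "x \<in> carr N" for r x
    using N that by (simp add: gmodule_def)
  have ad: "smul N (r + s) x = add N (smul N r x) (smul N s x)" if "x \<in> carr N" for r s x
    using N that by (simp add: gmodule_def)
  have ad2: "smul N r (add N x y) = add N (smul N r x) (smul N r y)" if "x \<in> carr N" "y \<in> carr N" for r x y
    using N that by (simp add: gmodule_def)
  have as: "smul N (\<mu> r s) x = smul N r (smul N s x)" if "x \<in> carr N" for r s x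
    using N that by (simp add: gmodule_def)
  have s0: "smul N 0 x = zer N" if "x \<in> carr N" for x
    using abgrp_part_cancel[OF ab cl[OF that, of 0]] ad[OF that, of 0 0] by simp
  have sz: "smul N r (zer N) = zer N" for r
    using abgrp_part_cancel[OF ab cl, of "zer N" r] ad2[of "zer N" "zer N" r] ab
    by (simp add: abgrp_part_def)
  \<comment> \<open>Extending \<open>g\<close> by zero puts all terms into \<open>N\<close>, so
    supports never have to be compared with \<open>I\<close>.\<close>
  define g' where "g' i = (if i \<in> I then g i else zer N)" for i
  have g': "g' i \<in> carr N" for i using g ab by (simp add: g'_def abgrp_part_def)
  define f where "f x = finprod ?G (\<lambda>i. smul N (x i) (g' i)) {i. x i \<noteq> 0}" for x
  \<comment> \<open>Supports can shrink under addition and scalar action, so \<open>f x\<close> is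
    computed over any finite set containing the support.\<close>
  have fA: "f x = finprod ?G (\<lambda>i. smul N (x i) (g' i)) A" if "finite A" "{i. x i \<noteq> 0} \<subseteq> A" for x A
    unfolding f_def
    by (rule finprod_mono_neutral_cong_left) (use that s0 cl g' in auto)
  have "mhom (gfree \<mu> I) N f"
    unfolding mhom_def
  proof (intro conjI ballI allI)
    fix x assume "x \<in> carr (gfree \<mu> I)"
    show "f x \<in> carr N" unfolding f_def
      using finprod_closed[of "\<lambda>i. smul N (x i) (g' i)" "{i. x i \<noteq> 0}"] cl g' by auto
  next
    fix x y assume "x \<in> carr (gfree \<mu> I)" "y \<in> carr (gfree \<mu> I)"
    then have fin: "finite {i. x i \<noteq> 0}" "finite {i. y i \<noteq> 0}" by (auto simp: gfree_def)
    let ?A = "{i. x i \<noteq> 0} \<union> {i. y i \<noteq> 0}"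
    have "f (add (gfree \<mu> I) x y) = finprod ?G (\<lambda>i. smul N (x i + y i) (g' i)) ?A"
      by (subst fA[of ?A]) (use fin in \<open>auto simp: gfree_def\<close>)
    also have "\<dots> = finprod ?G (\<lambda>i. smul N (x i) (g' i) \<otimes>\<^bsub>?G\<^esub> smul N (y i) (g' i)) ?A"
      using ad g' by simp
    also have "\<dots> = finprod ?G (\<lambda>i. smul N (x i) (g' i)) ?A \<otimes>\<^bsub>?G\<^esub> finprod ?G (\<lambda>i. smul N (y i) (g' i)) ?A"
      by (rule finprod_multf) (use cl g' in auto)
    also have "\<dots> = add N (f x) (f y)"
      using fA[of ?A x] fA[of ?A y] fin by simp
    finally show "f (add (gfree \<mu> I) x y) = add N (f x) (f y)" .
  next
    fix r x assume "x \<in> carr (gfree \<mu> I)"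
    then have fin: "finite {i. x i \<noteq> 0}" by (auto simp: gfree_def)
    have "f (smul (gfree \<mu> I) r x) = finprod ?G (\<lambda>i. smul N (\<mu> r (x i)) (g' i)) {i. x i \<noteq> 0}"
      by (subst fA[of "{i. x i \<noteq> 0}"]) (use fin mu in \<open>auto simp: gfree_def ring_or_opp_def\<close>)
    also have "\<dots> = finprod ?G (\<lambda>i. smul N r (smul N (x i) (g' i))) {i. x i \<noteq> 0}"
      using as g' by simp
    also have "\<dots> = smul N r (finprod ?G (\<lambda>i. smul N (x i) (g' i)) {i. x i \<noteq> 0})"
      using fin
    proof (induction rule: finite_induct)
      case empty
      then show ?case using sz by simp
    next
      case (insert a A)
      have "finprod ?G (\<lambda>i. smul N (x i) (g' i)) A \<in> carr N"
        using finprod_closed[of "\<lambda>i. smul N (x i) (g' i)" A] cl g' by auto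
      then show ?case using insert cl g' ad2 by (simp add: Pi_iff)
    qed
    finally show "f (smul (gfree \<mu> I) r x) = smul N r (f x)" by (simp add: f_def)
  qed
  moreover have "f (delta i) = g i" if "i \<in> I" for i
  proof -
    have "f (delta i) = finprod ?G (\<lambda>j. smul N (delta i j) (g' j)) {i}"
      by (rule fA) (auto simp: delta_def)
    also have "\<dots> = smul N 1 (g' i)"
      using r_one[of "smul N 1 (g' i)"] cl g' by simp
    also have "\<dots> = g i" using N g that by (simp add: gmodule_def g'_def)
    finally show ?thesis .
  qed
  ultimately show ?thesis by blast
qed

section \<open>Homomorphisms out of free modules, and lifting\<close>

lemma mhom_D:
  assumes "mhom M N f"
  shows "x \<in> carr M \<Longrightarrow> f x \<in> carr N"
    and "x \<in> carr M \<Longrightarrow> y \<in> carr M \<Longrightarrow> f (add M x y) = add N (f x) (f y)"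
    and "x \<in> carr M \<Longrightarrow> f (smul M r x) = smul N r (f x)"
  using assms unfolding mhom_def by blast+

lemma mhom_comp: "mhom M N f \<Longrightarrow> mhom N K g \<Longrightarrow> mhom M K (\<lambda>x. g (f x))"
  unfolding mhom_def by simp

lemma mhom_zero:
  assumes "abgrp_part M" "abgrp_part N" "mhom M N f"
  shows "f (zer M) = zer N"
proof -
  have z: "zer M \<in> carr M" "add M (zer M) (zer M) = zer M"
    using assms(1) by (auto simp: abgrp_part_def)
  show ?thesis
    using abgrp_part_cancel[OF assms(2), of "f (zer M)"] mhom_D(1)[OF assms(3) z(1)]
      mhom_D(2)[OF assms(3) z(1) z(1)] z(2) by simp
qed

lemma gfree_hom_eq:
  assumes "ring_or_opp \<mu>" "mhom (gfree \<mu> I) N f" "mhom (gfree \<mu> I) N g" "abgrp_part N"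
    and "\<And>i. i \<in> I \<Longrightarrow> f (delta i) = g (delta i)" and x: "x \<in> carr (gfree \<mu> I)"
  shows "f x = g x"
proof -
  have ab: "abgrp_part (gfree \<mu> I)" using gmodule_gfree[OF assms(1), of I] by (simp add: gmodule_def)
  have z: "zer (gfree \<mu> I) = (\<lambda>i. 0)" by (simp add: gfree_def)
  show ?thesis
  proof (rule gfree_induct[OF assms(1) x])
    show "f (\<lambda>i. 0) = g (\<lambda>i. 0)"
      using mhom_zero[OF ab assms(4,2)] mhom_zero[OF ab assms(4,3)] z by simp
  qed (simp_all add: mhom_D[OF assms(2)] mhom_D[OF assms(3)] assms(5))
qed

text \<open>Projectivity is tested on the free module over the carrier. The section sends a basis
  vector to the basis vector indexed by it, and the retraction evaluates formal
  combinations.\<close>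

lemma gfree_summand:
  assumes mu: "ring_or_opp \<mu>"
  shows "summand (gfree \<mu> I) (gfree \<mu> (carr (gfree \<mu> I)))"
proof -
  let ?P = "gfree \<mu> I" and ?X = "gfree \<mu> (carr (gfree \<mu> I))"
  have "\<exists>i. mhom ?P ?X i \<and> (\<forall>j\<in>I. i (delta j) = delta (delta j))"
    by (rule gfree_universal[OF mu gmodule_gfree[OF mu]]) simp
  then obtain i where i: "mhom ?P ?X i" "\<And>j. j \<in> I \<Longrightarrow> i (delta j) = delta (delta j)" by blast
  have "\<exists>p. mhom ?X ?P p \<and> (\<forall>x\<in>carr ?P. p (delta x) = x)"
    by (rule gfree_universal[OF mu gmodule_gfree[OF mu]])
  then obtain p where p: "mhom ?X ?P p" "\<And>x. x \<in> carr ?P \<Longrightarrow> p (delta x) = x" by blast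
  have "p (i x) = x" if x: "x \<in> carr ?P" for x
  proof (rule gfree_hom_eq[OF mu mhom_comp[OF i(1) p(1)] _ _ _ x])
    show "mhom ?P ?P (\<lambda>x. x)" by (simp add: mhom_def)
    show "abgrp_part ?P" using gmodule_gfree[OF mu, of I] by (simp add: gmodule_def)
    show "p (i (delta j)) = delta j" if "j \<in> I" for j using i(2) p(2) that by simp
  qed
  then show ?thesis using i(1) p(1) unfolding summand_def by blast
qed

lemma lprojective_free_lmod: "lprojective (free_lmod I)"
  using lmodule_free_lmod[of I] by (simp add: lprojective_def free_lmod_gfree gfree_summand)

lemma rprojective_free_rmod: "rprojective (free_rmod I)"
  by (simp add: rprojective_def rmodule_gmodule free_rmod_gfree gfree_summand gmodule_gfree)

text \<open>A lift is obtained by choosing preimages under \<open>h\<close> for the images of the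
  basis vectors; agreement on the basis gives agreement everywhere.\<close>

lemma free_lmod_lift:
  assumes N: "lmodule N" and M: "lmodule M" and f: "mhom (free_lmod I) N f"
    and h: "mhom M N h" "carr N \<subseteq> h ` carr M"
  shows "\<exists>g. mhom (free_lmod I) M g \<and> (\<forall>x\<in>carr (free_lmod I). h (g x) = f x)"
proof -
  have "\<forall>i\<in>I. \<exists>m. m \<in> carr M \<and> h m = f (delta i)"
  proof
    fix i assume "i \<in> I"
    then have "delta i \<in> carr (free_lmod I)" by (simp add: free_lmod_gfree)
    then have "f (delta i) \<in> h ` carr M" using mhom_D(1)[OF f] h(2) by blast
    then show "\<exists>m. m \<in> carr M \<and> h m = f (delta i)" by (auto simp: image_iff)
  qed
  from bchoice[OF this] obtain m where m: "\<forall>i\<in>I. m i \<in> carr M \<and> h (m i) = f (delta i)" ..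
  have "\<exists>g. mhom (gfree (*) I) M g \<and> (\<forall>i\<in>I. g (delta i) = m i)"
    by (rule gfree_universal) (use M m in \<open>simp_all add: lmodule_gmodule\<close>)
  then obtain g where g: "mhom (gfree (*) I) M g" "\<forall>i\<in>I. g (delta i) = m i" by blast
  have "h (g x) = f x" if x: "x \<in> carr (gfree (*) I)" for x
  proof (rule gfree_hom_eq[OF ring_or_opp_mult(1) mhom_comp[OF g(1) h(1)] _ _ _ x])
    show "mhom (gfree (*) I) N f" using f by (simp add: free_lmod_gfree)
    show "abgrp_part N" using N by (simp add: lmodule_def)
    show "h (g (delta i)) = f (delta i)" if "i \<in> I" for i using that g(2) m by simp
  qed
  then show ?thesis using g(1) unfolding free_lmod_gfree by blast
qed

text \<open>The map \<open>f\<close> composed with the retraction is lifted on the free module, and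
  the lift is restricted along the section.\<close>

lemma lprojective_lift:
  assumes P: "lprojective P" and N: "lmodule N" and M: "lmodule M" and f: "mhom P N f"
    and h: "mhom M N h" "carr N \<subseteq> h ` carr M"
  shows "\<exists>g. mhom P M g \<and> (\<forall>x\<in>carr P. h (g x) = f x)"
proof -
  obtain i p where ip: "mhom P (free_lmod (carr P)) i" "mhom (free_lmod (carr P)) P p"
    "\<And>x. x \<in> carr P \<Longrightarrow> p (i x) = x"
    using P unfolding lprojective_def summand_def by blast
  obtain g where g: "mhom (free_lmod (carr P)) M g"
    "\<And>x. x \<in> carr (free_lmod (carr P)) \<Longrightarrow> h (g x) = f (p x)"
    using free_lmod_lift[OF N M mhom_comp[OF ip(2) f] h] by blast
  show ?thesis
    by (rule exI[of _ "\<lambda>x. g (i x)"]) (use mhom_comp[OF ip(1) g(1)] g(2) ip(3) mhom_D(1)[OF ip(1)] in auto)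
qed

section \<open>Direct sums, negatives and submodules\<close>

lemma lmodule_dsum:
  assumes "lmodule M" "lmodule N"
  shows "lmodule (dsum M N)"
proof -
  note D = lmodule_D[OF assms(1)] lmodule_D[OF assms(2)]
  have inv: "\<exists>y\<in>carr K. add K x y = zer K" if "lmodule K" "x \<in> carr K" for K :: "('x::ring_1, 'y) lmod" and x
    using that unfolding lmodule_def abgrp_part_def by blast
  have "\<exists>y\<in>carr (dsum M N). add (dsum M N) x y = zer (dsum M N)" if "x \<in> carr (dsum M N)" for x
    using inv[OF assms(1), of "fst x"] inv[OF assms(2), of "snd x"] that
    by (fastforce simp: dsum_def)
  then show ?thesis
    unfolding lmodule_def abgrp_part_def
    by (intro conjI ballI allI) (auto simp: dsum_def D(1-3,5-13,15-20) intro: D(4) D(14))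
qed

lemma add_swap:
  assumes "lmodule M" "a \<in> carr M" "b \<in> carr M" "c \<in> carr M" "d \<in> carr M"
  shows "add M (add M a b) (add M c d) = add M (add M a c) (add M b d)"
proof -
  note D = lmodule_D(2-4)[OF assms(1)]
  have "add M (add M a b) (add M c d) = add M a (add M (add M b c) d)"
    using D(1,2) assms(2-) by simp
  also have "add M b c = add M c b" using D(3) assms(2-) by simp
  also have "add M a (add M (add M c b) d) = add M (add M a c) (add M b d)"
    using D(1,2) assms(2-) by simp
  finally show ?thesis .
qed

lemma smul_zer:
  assumes "lmodule M"
  shows "smul M r (zer M) = zer M"
proof (rule abgrp_part_cancel)
  note D = lmodule_D[OF assms]
  show "add M (smul M r (zer M)) (smul M r (zer M)) = smul M r (zer M)"
    using D(7)[of "zer M" "zer M" r] D(1,5) by simp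
qed (use assms lmodule_D[OF assms] in \<open>auto simp: lmodule_def\<close>)

lemma smul_zero:
  assumes "lmodule M" "x \<in> carr M"
  shows "smul M 0 x = zer M"
proof (rule abgrp_part_cancel)
  note D = lmodule_D[OF assms(1)]
  show "add M (smul M 0 x) (smul M 0 x) = smul M 0 x"
    using D(8)[of x 0 0] assms(2) by simp
qed (use assms lmodule_D[OF assms(1)] in \<open>auto simp: lmodule_def\<close>)

lemma add_zer_right:
  assumes "lmodule M" "x \<in> carr M"
  shows "add M x (zer M) = x"
  using lmodule_D(1,5)[OF assms(1)] lmodule_D(4)[OF assms(1), of x "zer M"] assms(2) by simp

text \<open>Lifts on the two summands are added. The direct sum thus has the lifting property
  without being exhibited as a summand of the free module on its own carrier.\<close>

lemma lprojective_dsum_free_lift: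
  assumes P: "lprojective P" and N: "lmodule N" and M: "lmodule M"
    and f: "mhom (dsum P (free_lmod I)) N f"
    and h: "mhom M N h" "carr N \<subseteq> h ` carr M"
  shows "\<exists>g. mhom (dsum P (free_lmod I)) M g \<and> (\<forall>x\<in>carr (dsum P (free_lmod I)). h (g x) = f x)"
proof -
  let ?F = "free_lmod I"
  note PD = lmodule_D[OF P[unfolded lprojective_def, THEN conjunct1]]
  note FD = lmodule_D[OF lmodule_free_lmod[of I]]
  note MD = lmodule_D[OF M]
  note z = smul_zer[OF P[unfolded lprojective_def, THEN conjunct1]] smul_zer[OF lmodule_free_lmod[of I]]
  have f1: "mhom P N (\<lambda>x. f (x, zer ?F))"
    by (rule mhom_comp[OF _ f]) (simp add: mhom_def dsum_def PD(1) FD(1) FD(5) z(2))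
  have f2: "mhom ?F N (\<lambda>x. f (zer P, x))"
    by (rule mhom_comp[OF _ f]) (simp add: mhom_def dsum_def PD(1) PD(5) z(1))
  obtain g1 where g1: "mhom P M g1" "\<And>x. x \<in> carr P \<Longrightarrow> h (g1 x) = f (x, zer ?F)"
    using lprojective_lift[OF P N M f1 h] by blast
  obtain g2 where g2: "mhom ?F M g2" "\<And>x. x \<in> carr ?F \<Longrightarrow> h (g2 x) = f (zer P, x)"
    using free_lmod_lift[OF N M f2 h] by blast
  define g where "g = (\<lambda>(x, y). add M (g1 x) (g2 y))"
  have "mhom (dsum P ?F) M g"
    unfolding mhom_def
    using mhom_D[OF g1(1)] mhom_D[OF g2(1)] MD add_swap[OF M]
    by (auto simp: dsum_def g_def)
  moreover have "h (g (x, y)) = f (x, y)" if "x \<in> carr P" "y \<in> carr ?F" for x y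
  proof -
    have "h (g (x, y)) = add N (f (x, zer ?F)) (f (zer P, y))"
      using that g1 g2 mhom_D[OF h(1)] mhom_D(1)[OF g1(1)] mhom_D(1)[OF g2(1)] by (simp add: g_def)
    also have "\<dots> = f (add (dsum P ?F) (x, zer ?F) (zer P, y))"
      by (rule mhom_D(2)[OF f, symmetric]) (use that PD FD in \<open>auto simp: dsum_def\<close>)
    also have "add (dsum P ?F) (x, zer ?F) (zer P, y) = (x, y)"
      using that PD(5) add_zer_right[OF P[unfolded lprojective_def, THEN conjunct1]] FD(5)
      by (simp add: dsum_def)
    finally show ?thesis .
  qed
  ultimately show ?thesis by (intro exI[of _ g]) (auto simp: dsum_def)
qed

text \<open>The record has no negation; additive inverses are written as multiples by
  \<open>- 1\<close>, here and later.\<close>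

lemma add_neg:
  assumes "lmodule M" "x \<in> carr M"
  shows "add M x (smul M (- 1) x) = zer M"
  using lmodule_D(8,10)[OF assms(1), of x] lmodule_D(8)[OF assms(1), of x 1 "- 1"] assms
    smul_zero[OF assms] by simp

lemma mhom_zer:
  "lmodule M \<Longrightarrow> lmodule N \<Longrightarrow> mhom M N f \<Longrightarrow> f (zer M) = zer N"
  using mhom_zero[of M N f] by (simp add: lmodule_def)

lemma submodule_vimage:
  assumes "lmodule M" "lmodule N" "mhom M N f" "submodule S N"
  shows "submodule {x \<in> carr M. f x \<in> S} M"
  using lmodule_D[OF assms(1)] mhom_D[OF assms(3)] mhom_zer[OF assms(1-3)] assms(4)
  unfolding submodule_def by auto

lemma submodule_D:
  assumes "submodule S M"
  shows "x \<in> S \<Longrightarrow> x \<in> carr M" "zer M \<in> S"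
    "x \<in> S \<Longrightarrow> y \<in> S \<Longrightarrow> add M x y \<in> S" "x \<in> S \<Longrightarrow> smul M r x \<in> S"
  using assms unfolding submodule_def by auto

lemma submodule_zer: "lmodule M \<Longrightarrow> submodule {zer M} M"
  using lmodule_D(1,5)[of M] smul_zer[of M] by (simp add: submodule_def)

lemma submodule_Int: "submodule S M \<Longrightarrow> submodule T M \<Longrightarrow> submodule (S \<inter> T) M"
  unfolding submodule_def by blast

lemma span_subset: "submodule T M \<Longrightarrow> S \<subseteq> T \<Longrightarrow> span M S \<subseteq> T"
  unfolding span_def by blast

lemma span_superset: "S \<subseteq> span M S"
  unfolding span_def by blast

section \<open>Duals of projective right modules\<close>

lemma dual_simps [simp]:
  "add (dual Q) \<phi> \<psi> = restrict (\<lambda>x. \<phi> x + \<psi> x) (carr Q)"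
  "zer (dual Q) = restrict (\<lambda>x. 0) (carr Q)"
  "smul (dual Q) r \<phi> = restrict (\<lambda>x. r * \<phi> x) (carr Q)"
  by (simp_all add: dual_def)

lemma carr_dual: "\<phi> \<in> carr (dual Q) \<longleftrightarrow> \<phi> \<in> extensional (carr Q) \<and> mhom Q ring_rmod \<phi>"
  by (simp add: dual_def)

lemma rmodule_closed:
  assumes "rmodule Q"
  shows "x \<in> carr Q \<Longrightarrow> y \<in> carr Q \<Longrightarrow> add Q x y \<in> carr Q" "x \<in> carr Q \<Longrightarrow> smul Q r x \<in> carr Q"
  using assms unfolding rmodule_def abgrp_part_def by simp_all

lemma restrict_in_dual:
  assumes "rmodule Q" "mhom Q ring_rmod \<phi>"
  shows "restrict \<phi> (carr Q) \<in> carr (dual Q)"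
  using assms(2) rmodule_closed[OF assms(1)] by (simp add: carr_dual mhom_def)

lemma lmodule_dual:
  assumes "rmodule Q"
  shows "lmodule (dual Q)"
proof -
  have 1: "add (dual Q) \<phi> \<psi> \<in> carr (dual Q)" if "\<phi> \<in> carr (dual Q)" "\<psi> \<in> carr (dual Q)" for \<phi> \<psi>
    unfolding dual_simps
    by (rule restrict_in_dual[OF assms]) (use that in \<open>simp add: carr_dual mhom_def ring_rmod_def algebra_simps\<close>)
  have 2: "smul (dual Q) r \<phi> \<in> carr (dual Q)" if "\<phi> \<in> carr (dual Q)" for r \<phi>
    unfolding dual_simps
    by (rule restrict_in_dual[OF assms]) (use that in \<open>simp add: carr_dual mhom_def ring_rmod_def algebra_simps\<close>)
  have 3: "zer (dual Q) \<in> carr (dual Q)"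
    unfolding dual_simps
    by (rule restrict_in_dual[OF assms]) (simp add: mhom_def ring_rmod_def)
  have 4: "\<exists>y\<in>carr (dual Q). add (dual Q) \<phi> y = zer (dual Q)" if "\<phi> \<in> carr (dual Q)" for \<phi>
    using 2[OF that, of "- 1"] by (intro bexI[of _ "smul (dual Q) (- 1) \<phi>"]) auto
  have ext: "restrict \<phi> (carr Q) = \<phi>" if "\<phi> \<in> carr (dual Q)" for \<phi>
    using that by (simp add: carr_dual extensional_restrict)
  have group: "abgrp_part (dual Q)"
    unfolding abgrp_part_def
  proof (intro conjI ballI)
    fix x assume x: "x \<in> carr (dual Q)"
    have "add (dual Q) (zer (dual Q)) x = restrict x (carr Q)" by (auto simp: restrict_def)
    then show "add (dual Q) (zer (dual Q)) x = x" using ext[OF x] by simp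
    show "\<exists>y\<in>carr (dual Q). add (dual Q) x y = zer (dual Q)" by (rule 4[OF x])
    fix y assume "y \<in> carr (dual Q)"
    then show "add (dual Q) x y \<in> carr (dual Q)" by (rule 1[OF x])
    show "add (dual Q) x y = add (dual Q) y x" by (simp add: add.commute)
    fix z show "add (dual Q) (add (dual Q) x y) z = add (dual Q) x (add (dual Q) y z)"
      by (auto simp: restrict_def algebra_simps)
  qed (rule 3)
  show ?thesis
    unfolding lmodule_def
  proof (intro conjI ballI allI group)
    fix r s x assume x: "x \<in> carr (dual Q)"
    show "smul (dual Q) r x \<in> carr (dual Q)" by (rule 2[OF x])
    show "smul (dual Q) 1 x = x" using ext[OF x] by simp
    show "smul (dual Q) (r + s) x = add (dual Q) (smul (dual Q) r x) (smul (dual Q) s x)"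
      "smul (dual Q) (r * s) x = smul (dual Q) r (smul (dual Q) s x)"
      by (auto simp: restrict_def algebra_simps)
    fix y show "smul (dual Q) r (add (dual Q) x y) = add (dual Q) (smul (dual Q) r x) (smul (dual Q) r y)"
      by (auto simp: restrict_def algebra_simps)
  qed
qed

section \<open>Topology of the sum of \<open>P\<close> and the dual of \<open>Q\<close>, and dual
  bases\<close>

definition model_top :: "('r::ring_1, 'p) lmod \<Rightarrow> ('r, 'q) lmod \<Rightarrow> ('p \<times> ('q \<Rightarrow> 'r)) topology" where
  "model_top P Q = prod_topology (discrete_topology (carr P)) (dual_top Q)"

lemma topspace_dual_top: "topspace (dual_top Q) = carr (dual Q)"
  by (auto simp: dual_top_def carr_dual PiE_def)

lemma topspace_model_top: "topspace (model_top P Q) = carr (dsum P (dual Q))"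
  by (simp add: model_top_def topspace_dual_top dsum_def)

text \<open>A basic open set of the product restricts finitely many coordinates, and since the
  factors are discrete the restriction can be sharpened to agreement with \<phi>.\<close>

lemma openin_dual_top:
  "openin (dual_top Q) V \<longleftrightarrow> V \<subseteq> carr (dual Q) \<and>
     (\<forall>\<phi>\<in>V. \<exists>F. finite F \<and> F \<subseteq> carr Q \<and>
        (\<forall>\<psi>\<in>carr (dual Q). (\<forall>x\<in>F. \<psi> x = \<phi> x) \<longrightarrow> \<psi> \<in> V))"
proof (intro iffI conjI ballI)
  assume o: "openin (dual_top Q) V"
  show "V \<subseteq> carr (dual Q)" using openin_subset[OF o] by (simp add: topspace_dual_top)
  fix \<phi> assume \<phi>: "\<phi> \<in> V"
  obtain W where W: "openin (product_topology (\<lambda>_. discrete_topology UNIV) (carr Q)) W"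
      "V = W \<inter> carr (dual Q)"
    using o unfolding dual_top_def openin_subtopology by blast
  have "\<phi> \<in> W" using \<phi> W(2) by blast
  from bspec[OF W(1)[unfolded openin_product_topology_alt] this]
  obtain U where "finite {i \<in> carr Q. U i \<noteq> topspace (discrete_topology UNIV)}"
      "\<phi> \<in> Pi\<^sub>E (carr Q) U" "Pi\<^sub>E (carr Q) U \<subseteq> W"
    by (elim exE conjE)
  then have U: "finite {i \<in> carr Q. U i \<noteq> UNIV}" "\<phi> \<in> Pi\<^sub>E (carr Q) U" "Pi\<^sub>E (carr Q) U \<subseteq> W"
    by simp_all
  \<comment> \<open>The finite set consists of the coordinates on which the basic box imposes a
    condition.\<close>
  show "\<exists>F. finite F \<and> F \<subseteq> carr Q \<and> (\<forall>\<psi>\<in>carr (dual Q). (\<forall>x\<in>F. \<psi> x = \<phi> x) \<longrightarrow> \<psi> \<in> V)"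
  proof (intro exI[of _ "{i \<in> carr Q. U i \<noteq> UNIV}"] conjI ballI impI)
    fix \<psi> assume \<psi>: "\<psi> \<in> carr (dual Q)" "\<forall>x\<in>{i \<in> carr Q. U i \<noteq> UNIV}. \<psi> x = \<phi> x"
    have "\<psi> x \<in> U x" if "x \<in> carr Q" for x
      using \<psi>(2) PiE_mem[OF U(2) that] that by (cases "U x = UNIV") simp_all
    then have "\<psi> \<in> Pi\<^sub>E (carr Q) U" using \<psi>(1) unfolding carr_dual PiE_def by blast
    then show "\<psi> \<in> V" using U(3) W(2) \<psi>(1) by blast
  qed (use U(1) in blast)+
next
  assume V: "V \<subseteq> carr (dual Q) \<and>
     (\<forall>\<phi>\<in>V. \<exists>F. finite F \<and> F \<subseteq> carr Q \<and>
        (\<forall>\<psi>\<in>carr (dual Q). (\<forall>x\<in>F. \<psi> x = \<phi> x) \<longrightarrow> \<psi> \<in> V))"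
  show "openin (dual_top Q) V"
  proof (subst openin_subopen, intro ballI)
    fix \<phi> assume \<phi>: "\<phi> \<in> V"
    from bspec[OF conjunct2[OF V] this] obtain F where F: "finite F" "F \<subseteq> carr Q"
      "\<forall>\<psi>\<in>carr (dual Q). (\<forall>x\<in>F. \<psi> x = \<phi> x) \<longrightarrow> \<psi> \<in> V" by (elim exE conjE)
    have d: "\<phi> \<in> carr (dual Q)" using \<phi> V by blast
    let ?B = "Pi\<^sub>E (carr Q) (\<lambda>x. if x \<in> F then {\<phi> x} else UNIV)"
    have "{x. (if x \<in> F then {\<phi> x} else UNIV) \<noteq> topspace (discrete_topology UNIV)} \<subseteq> F"
      by (auto split: if_splits)
    from finite_subset[OF this F(1)]
    have "openin (product_topology (\<lambda>_. discrete_topology UNIV) (carr Q)) ?B"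
      by (intro product_topology_basis) simp_all
    then have "openin (dual_top Q) (?B \<inter> carr (dual Q))"
      unfolding dual_top_def by (rule openin_subtopology_Int)
    moreover have "\<phi> \<in> ?B \<inter> carr (dual Q)" using d by (simp add: carr_dual PiE_iff)
    moreover have "?B \<inter> carr (dual Q) \<subseteq> V"
    proof
      fix \<psi> assume \<psi>: "\<psi> \<in> ?B \<inter> carr (dual Q)"
      have "\<psi> x = \<phi> x" if "x \<in> F" for x
        using PiE_mem[of \<psi> "carr Q" "\<lambda>x. if x \<in> F then {\<phi> x} else UNIV" x] \<psi> subsetD[OF F(2) that] that
        by simp
      then show "\<psi> \<in> V" using F(3) \<psi> by simp
    qed
    ultimately show "\<exists>T. openin (dual_top Q) T \<and> \<phi> \<in> T \<and> T \<subseteq> V" by blast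
  qed
qed

text \<open>The first factor is discrete, so a neighbourhood may keep \<open>u\<close> fixed while
  only the functional varies.\<close>

lemma openin_model_top:
  "openin (model_top P Q) V \<longleftrightarrow> V \<subseteq> carr P \<times> carr (dual Q) \<and>
     (\<forall>u \<phi>. (u, \<phi>) \<in> V \<longrightarrow> (\<exists>F. finite F \<and> F \<subseteq> carr Q \<and>
        (\<forall>\<psi>\<in>carr (dual Q). (\<forall>x\<in>F. \<psi> x = \<phi> x) \<longrightarrow> (u, \<psi>) \<in> V)))"
proof (intro iffI conjI allI impI)
  assume o: "openin (model_top P Q) V"
  show "V \<subseteq> carr P \<times> carr (dual Q)"
    using openin_subset[OF o] by (simp add: topspace_model_top dsum_def)
  fix u \<phi> assume "(u, \<phi>) \<in> V"
  then have "\<exists>A B. openin (discrete_topology (carr P)) A \<and> openin (dual_top Q) B \<and>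
      u \<in> A \<and> \<phi> \<in> B \<and> A \<times> B \<subseteq> V"
    using o unfolding model_top_def openin_prod_topology_alt by simp
  then obtain A B where AB: "openin (dual_top Q) B" "u \<in> A" "\<phi> \<in> B" "A \<times> B \<subseteq> V"
    by blast
  from bspec[OF conjunct2[OF AB(1)[unfolded openin_dual_top]] AB(3)]
  obtain F where F: "finite F" "F \<subseteq> carr Q" "\<forall>\<psi>\<in>carr (dual Q). (\<forall>x\<in>F. \<psi> x = \<phi> x) \<longrightarrow> \<psi> \<in> B"
    by (elim exE conjE)
  have "(u, \<psi>) \<in> V" if "\<psi> \<in> B" for \<psi> using that AB(2,4) by blast
  with F show "\<exists>F. finite F \<and> F \<subseteq> carr Q \<and> (\<forall>\<psi>\<in>carr (dual Q). (\<forall>x\<in>F. \<psi> x = \<phi> x) \<longrightarrow> (u, \<psi>) \<in> V)"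
    by blast
next
  assume V: "V \<subseteq> carr P \<times> carr (dual Q) \<and>
     (\<forall>u \<phi>. (u, \<phi>) \<in> V \<longrightarrow> (\<exists>F. finite F \<and> F \<subseteq> carr Q \<and>
        (\<forall>\<psi>\<in>carr (dual Q). (\<forall>x\<in>F. \<psi> x = \<phi> x) \<longrightarrow> (u, \<psi>) \<in> V)))"
  show "openin (model_top P Q) V"
    unfolding model_top_def openin_prod_topology_alt
  proof (intro allI impI)
    fix u \<phi> assume u: "(u, \<phi>) \<in> V"
    have "openin (dual_top Q) {\<psi> \<in> carr (dual Q). (u, \<psi>) \<in> V}"
      unfolding openin_dual_top using V by simp
    moreover have "openin (discrete_topology (carr P)) {u}" using u V by auto
    ultimately show "\<exists>A B. openin (discrete_topology (carr P)) A \<and> openin (dual_top Q) B \<and>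
        u \<in> A \<and> \<phi> \<in> B \<and> A \<times> B \<subseteq> V"
      using u conjunct1[OF V]
      by (intro exI[of _ "{u}"] exI[of _ "{\<psi> \<in> carr (dual Q). (u, \<psi>) \<in> V}"]) auto
  qed
qed

text \<open>Elements of the free module have finite support, so an arbitrary family \<open>d\<close>
  of coefficients defines a functional. Coefficients stand on the left because scalars act on the
  right.\<close>

lemma mhom_free_rmod_sum:
  "mhom (free_rmod K) ring_rmod (\<lambda>y. \<Sum>j | y j \<noteq> 0. d j * y j)"
proof -
  have ext: "(\<Sum>j | y j \<noteq> 0. d j * y j) = (\<Sum>j\<in>A. d j * y j)"
    if "finite A" "{j. y j \<noteq> 0} \<subseteq> A" for y A
    by (rule sum.mono_neutral_left) (use that in auto)
  have "(\<Sum>j | y j + z j \<noteq> 0. d j * (y j + z j)) = (\<Sum>j | y j \<noteq> 0. d j * y j) + (\<Sum>j | z j \<noteq> 0. d j * z j)"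
    if "finite {j. y j \<noteq> 0}" "finite {j. z j \<noteq> 0}" for y z
  proof -
    let ?A = "{j. y j \<noteq> 0} \<union> {j. z j \<noteq> 0}"
    have "{j. y j + z j \<noteq> 0} \<subseteq> ?A" by auto
    then show ?thesis
      using ext[of ?A y] ext[of ?A z] ext[of ?A "\<lambda>j. y j + z j"] that
      by (simp add: sum.distrib[symmetric] algebra_simps)
  qed
  moreover have "(\<Sum>j | y j * r \<noteq> 0. d j * (y j * r)) = (\<Sum>j | y j \<noteq> 0. d j * y j) * r"
    if "finite {j. y j \<noteq> 0}" for y r
  proof -
    have "{j. y j * r \<noteq> 0} \<subseteq> {j. y j \<noteq> 0}" by auto
    then show ?thesis
      using ext[of "{j. y j \<noteq> 0}" "\<lambda>j. y j * r"] that
      by (simp add: sum_distrib_right mult.assoc)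
  qed
  ultimately show ?thesis by (simp add: mhom_def free_rmod_def ring_rmod_def)
qed

lemma abgrp_part_ring_rmod: "abgrp_part ring_rmod"
proof -
  have "\<exists>y. x + y = 0" for x :: 'a by (rule exI[of _ "- x"]) simp
  then show ?thesis by (simp add: abgrp_part_def ring_rmod_def algebra_simps)
qed

text \<open>Both sides are homomorphisms of right modules that agree on the basis vectors.\<close>

lemma free_rmod_functional:
  assumes "mhom (free_rmod K) ring_rmod \<psi>" "y \<in> carr (free_rmod K)"
  shows "\<psi> y = (\<Sum>j | y j \<noteq> 0. \<psi> (delta j) * y j)"
proof -
  have "(\<Sum>j | delta i j \<noteq> (0::'a). \<psi> (delta j) * delta i j) = \<psi> (delta i)" for i
  proof -
    have "{j. delta i j \<noteq> (0::'a)} = {i}" by (auto simp: delta_def)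
    then show ?thesis by simp
  qed
  then show ?thesis
    using gfree_hom_eq[OF ring_or_opp_mult(2) _ _ abgrp_part_ring_rmod, of K \<psi>
        "\<lambda>y. \<Sum>j | y j \<noteq> 0. \<psi> (delta j) * y j" y] assms mhom_free_rmod_sum[of K "\<lambda>j. \<psi> (delta j)"]
    by (simp add: free_rmod_gfree)
qed

text \<open>The dual basis lemma: \<open>c x\<close> are the coordinates of \<open>x\<close> in a
  free module having \<open>Q\<close> as a summand, and \<open>e j\<close> are the images of its
  basis vectors under the retraction. Pulled back along the retraction, \<phi> is determined by its
  values on the basis.\<close>

lemma rprojective_dual_expand:
  assumes "rprojective Q"
  shows "\<exists>c e. (\<forall>x\<in>carr Q. finite {j. c x j \<noteq> 0}) \<and> (\<forall>x\<in>carr Q. \<forall>j. j \<notin> carr Q \<longrightarrow> c x j = 0) \<and>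
    (\<forall>j\<in>carr Q. e j \<in> carr Q) \<and> (\<forall>j. mhom Q ring_rmod (\<lambda>x. c x j)) \<and>
    (\<forall>\<phi>\<in>carr (dual Q). \<forall>x\<in>carr Q. \<phi> x = (\<Sum>j | c x j \<noteq> 0. \<phi> (e j) * c x j))"
proof -
  obtain i p where ip: "mhom Q (free_rmod (carr Q)) i" "mhom (free_rmod (carr Q)) Q p"
    "\<forall>x\<in>carr Q. p (i x) = x"
    using assms unfolding rprojective_def summand_def by blast
  have ic: "i x \<in> carr (free_rmod (carr Q))" if "x \<in> carr Q" for x
    using mhom_D(1)[OF ip(1) that] .
  show ?thesis
  proof (intro exI[of _ i] exI[of _ "\<lambda>j. p (delta j)"] conjI ballI allI impI)
    fix x assume "x \<in> carr Q"
    from ic[OF this] show "finite {j. i x j \<noteq> 0}" by (simp add: free_rmod_def)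
    fix j assume "j \<notin> carr Q"
    with ic[OF \<open>x \<in> carr Q\<close>] show "i x j = 0" by (simp add: free_rmod_def)
  next
    fix j assume "j \<in> carr Q"
    then have "delta j \<in> carr (free_rmod (carr Q))" by (simp add: free_rmod_gfree)
    then show "p (delta j) \<in> carr Q" using mhom_D(1)[OF ip(2)] by blast
  next
    fix j show "mhom Q ring_rmod (\<lambda>x. i x j)"
      by (rule mhom_comp[OF ip(1)]) (simp add: mhom_def ring_rmod_def free_rmod_def)
  next
    fix \<phi> x assume \<phi>: "\<phi> \<in> carr (dual Q)" and x: "x \<in> carr Q"
    have "mhom Q ring_rmod \<phi>" using \<phi> by (simp add: carr_dual)
    from free_rmod_functional[OF mhom_comp[OF ip(2) this] ic[OF x]]
    show "\<phi> x = (\<Sum>j | i x j \<noteq> 0. \<phi> (p (delta j)) * i x j)" using ip(3) x by simp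
  qed
qed

lemma submodule_image:
  assumes "lmodule M" "lmodule N" "mhom M N f" "submodule S M"
  shows "submodule (f ` S) N"
  unfolding submodule_def
proof (intro conjI ballI allI)
  note F = mhom_D[OF assms(3)]
  have S: "S \<subseteq> carr M" "zer M \<in> S" "\<And>x y. x \<in> S \<Longrightarrow> y \<in> S \<Longrightarrow> add M x y \<in> S"
    "\<And>r x. x \<in> S \<Longrightarrow> smul M r x \<in> S"
    using assms(4) by (auto simp: submodule_def)
  show "f ` S \<subseteq> carr N" using F(1) S(1) by blast
  show "zer N \<in> f ` S" using mhom_zer[OF assms(1-3)] S(2) by force
  fix u assume "u \<in> f ` S"
  then obtain x where x: "u = f x" "x \<in> S" by blast
  have "smul N r u = f (smul M r x)" for r using F(3) x S(1) by auto
  then show "smul N r u \<in> f ` S" for r using S(4) x(2) by simp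
  fix v assume "v \<in> f ` S"
  then obtain y where y: "v = f y" "y \<in> S" by blast
  have "add N u v = f (add M x y)" using F(2)[OF subsetD[OF S(1) x(2)] subsetD[OF S(1) y(2)]] x(1) y(1) by simp
  then show "add N u v \<in> f ` S" using S(3) x(2) y(2) by simp
qed

text \<open>Only finitely many coordinate functionals are nonzero somewhere on \<open>F\<close>, and
  modulo functionals vanishing on \<open>F\<close> they generate the dual. Generation is phrased
  through submodules \<open>Y\<close> so that it applies directly to preimages of
  submodules.\<close>

lemma dual_fin_gen_mod_open:
  assumes Q: "rprojective Q" and F: "finite F" "F \<subseteq> carr Q"
  shows "\<exists>\<Xi>. finite \<Xi> \<and> \<Xi> \<subseteq> carr (dual Q) \<and>
    (\<forall>Y. submodule Y (dual Q) \<and> \<Xi> \<subseteq> Y \<and> {\<psi> \<in> carr (dual Q). \<forall>x\<in>F. \<psi> x = 0} \<subseteq> Y \<longrightarrow> carr (dual Q) \<subseteq> Y)"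
proof -
  have rQ: "rmodule Q" using Q by (simp add: rprojective_def)
  note lD = lmodule_dual[OF rQ]
  from rprojective_dual_expand[OF Q]
  obtain c e where c: "\<forall>x\<in>carr Q. finite {j. c x j \<noteq> 0}"
      "\<forall>x\<in>carr Q. \<forall>j. j \<notin> carr Q \<longrightarrow> c x j = 0"
    and e: "\<forall>j\<in>carr Q. e j \<in> carr Q"
    and c3: "\<forall>j. mhom Q ring_rmod (\<lambda>x. c x j)"
    and ce: "\<forall>\<phi>\<in>carr (dual Q). \<forall>x\<in>carr Q. \<phi> x = (\<Sum>j | c x j \<noteq> 0. \<phi> (e j) * c x j)"
    by (elim exE conjE)
  define J where "J = (\<Union>x\<in>F. {j. c x j \<noteq> 0})"
  have J: "finite J" using F c(1) unfolding J_def by blast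
  define \<xi> where "\<xi> j = restrict (\<lambda>x. c x j) (carr Q)" for j
  have \<xi>: "\<xi> j \<in> carr (dual Q)" for j
    unfolding \<xi>_def using restrict_in_dual[OF rQ] c3 by blast
  show ?thesis
  proof (intro exI[of _ "\<xi> ` J"] conjI allI impI subsetI)
    fix Y \<phi> assume Y: "submodule Y (dual Q) \<and> \<xi> ` J \<subseteq> Y \<and> {\<psi> \<in> carr (dual Q). \<forall>x\<in>F. \<psi> x = 0} \<subseteq> Y"
      and \<phi>: "\<phi> \<in> carr (dual Q)"
    have Yd: "Y \<subseteq> carr (dual Q)" "zer (dual Q) \<in> Y"
      "\<And>x y. x \<in> Y \<Longrightarrow> y \<in> Y \<Longrightarrow> add (dual Q) x y \<in> Y" "\<And>r x. x \<in> Y \<Longrightarrow> smul (dual Q) r x \<in> Y"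
      using Y by (auto simp only: submodule_def)
    \<comment> \<open>Partial sums of the dual basis expansion of \<phi>; they lie in
      \<open>Y\<close> by induction on the index set.\<close>
    define s where "s A = restrict (\<lambda>x. \<Sum>j\<in>A. \<phi> (e j) * c x j) (carr Q)" for A
    have s: "s A \<in> Y" if "finite A" "A \<subseteq> J" for A
      using that
    proof (induction A rule: finite_induct)
      case empty
      have "s {} = zer (dual Q)" by (auto simp: s_def restrict_def)
      then show ?case using Yd(2) by (simp only:)
    next
      case (insert a A)
      have "s (insert a A) = add (dual Q) (smul (dual Q) (\<phi> (e a)) (\<xi> a)) (s A)"
        using insert(1,2) by (auto simp: s_def \<xi>_def restrict_def)
      moreover have "smul (dual Q) (\<phi> (e a)) (\<xi> a) \<in> Y" using Yd(4) insert(4) Y by blast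
      moreover have "s A \<in> Y" using insert by blast
      ultimately show ?case using Yd(3) by (simp only:)
    qed
    \<comment> \<open>On \<open>F\<close> the expansion of \<phi> involves only indices in
      \<open>J\<close>, so \<phi> and \<open>s J\<close> agree there.\<close>
    define \<psi> where "\<psi> = add (dual Q) \<phi> (smul (dual Q) (- 1) (s J))"
    have sJ: "s J \<in> Y" using s[OF J] by simp
    have \<psi>: "\<psi> \<in> carr (dual Q)"
      unfolding \<psi>_def using lmodule_D(2,6)[OF lD] \<phi> sJ Yd(1) by blast
    have "\<psi> x = 0" if x: "x \<in> F" for x
    proof -
      have xQ: "x \<in> carr Q" using x F(2) by blast
      have "\<phi> x = (\<Sum>j | c x j \<noteq> 0. \<phi> (e j) * c x j)" using ce \<phi> xQ by blast
      also have "\<dots> = (\<Sum>j\<in>J. \<phi> (e j) * c x j)"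
        by (rule sum.mono_neutral_left) (use J x in \<open>auto simp: J_def\<close>)
      finally show ?thesis using xQ by (simp add: \<psi>_def s_def)
    qed
    then have "\<psi> \<in> Y" using Y \<psi> by blast
    from Yd(3)[OF this sJ] have "add (dual Q) \<psi> (s J) \<in> Y" .
    moreover have "add (dual Q) \<psi> (s J) = restrict \<phi> (carr Q)"
      by (auto simp: \<psi>_def restrict_def)
    ultimately show "\<phi> \<in> Y" using \<phi> by (simp add: carr_dual extensional_restrict)
  qed (use J \<xi> in auto)
qed

section \<open>Quotients that are 2-almost projective\<close>

text \<open>The preimage of \<open>L\<close> contains all functionals vanishing on some finite set
  \<open>F\<close>. By the dual basis, a functional on \<open>F\<close> is determined by its values
  at finitely many \<open>e j\<close>, so modulo \<open>L\<close> an element is determined by these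
  values and its discrete component.\<close>

lemma tate_factor:
  fixes M :: "('r::ring_1, 'm) lmod"
  assumes tate: "tate TYPE('p) TYPE('q) M \<tau>" and L: "submodule L M" "openin \<tau> L"
  shows "\<exists>(P :: ('r, 'p) lmod) (J :: 'q set) \<gamma> \<delta>. lprojective P \<and>
    mhom M (dsum P (free_lmod J)) \<gamma> \<and> mhom (dsum P (free_lmod J)) M \<delta> \<and>
    (\<forall>m\<in>carr M. add M m (smul M (- 1) (\<delta> (\<gamma> m))) \<in> L) \<and>
    openin \<tau> {m \<in> carr M. \<gamma> m = zer (dsum P (free_lmod J))}"
proof -
  from tate obtain P :: "('r, 'p) lmod" and Q :: "('r, 'q) lmod" and i p where
    M: "lmodule M" and top: "topspace \<tau> = carr M" and P: "lprojective P" and Q: "rprojective Q" and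
    i: "mhom M (dsum P (dual Q)) i" "continuous_map \<tau> (model_top P Q) i" and
    p: "mhom (dsum P (dual Q)) M p" "continuous_map (model_top P Q) \<tau> p" and
    pi: "\<forall>x\<in>carr M. p (i x) = x"
    unfolding tate_def model_top_def by (elim conjE exE)
  have lP: "lmodule P" and rQ: "rmodule Q" using P Q by (auto simp: lprojective_def rprojective_def)
  note lD = lmodule_dual[OF rQ]
  note lT = lmodule_dsum[OF lP lD]
  from rprojective_dual_expand[OF Q]
  obtain c e where c: "\<forall>x\<in>carr Q. finite {j. c x j \<noteq> 0}"
      "\<forall>x\<in>carr Q. \<forall>j. j \<notin> carr Q \<longrightarrow> c x j = 0"
    and e: "\<forall>j\<in>carr Q. e j \<in> carr Q"
    and c3: "\<forall>j. mhom Q ring_rmod (\<lambda>x. c x j)"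
    and ce: "\<forall>\<phi>\<in>carr (dual Q). \<forall>x\<in>carr Q. \<phi> x = (\<Sum>j | c x j \<noteq> 0. \<phi> (e j) * c x j)"
    by (elim exE conjE)
  have "openin (model_top P Q) {t \<in> topspace (model_top P Q). p t \<in> L}"
    by (rule openin_continuous_map_preimage[OF p(2) L(2)])
  note o = this[unfolded openin_model_top, THEN conjunct2, rule_format]
  \<comment> \<open>Zero lies in the open preimage of \<open>L\<close>; a basic neighbourhood of it
    provides \<open>F\<close>.\<close>
  have "(zer P, zer (dual Q)) \<in> {t \<in> topspace (model_top P Q). p t \<in> L}"
    using lmodule_D(1)[OF lT] mhom_zer[OF lT M p(1)] L(1)
    by (simp add: topspace_model_top submodule_def) (simp add: dsum_def)
  from o[OF this] obtain F where F: "finite F" "F \<subseteq> carr Q"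
    "\<forall>\<psi>\<in>carr (dual Q). (\<forall>x\<in>F. \<psi> x = zer (dual Q) x) \<longrightarrow> (zer P, \<psi>) \<in> {t \<in> topspace (model_top P Q). p t \<in> L}"
    by (elim exE conjE)
  have pL: "p (zer P, \<psi>) \<in> L" if "\<psi> \<in> carr (dual Q)" "\<And>x. x \<in> F \<Longrightarrow> \<psi> x = 0" for \<psi>
  proof -
    have "zer (dual Q) x = 0" if "x \<in> F" for x using F(2) that by auto
    then show ?thesis using F(3) that by simp
  qed
  define J where "J = (\<Union>x\<in>F. {j. c x j \<noteq> 0})"
  have J: "finite J" "J \<subseteq> carr Q"
    using F(1,2) c(1,2) unfolding J_def by blast+
  define \<xi> where "\<xi> a = restrict (\<lambda>x. \<Sum>j\<in>J. a j * c x j) (carr Q)" for a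
  have \<xi>: "\<xi> a \<in> carr (dual Q)" for a
    unfolding \<xi>_def
  proof (rule restrict_in_dual[OF rQ])
    show "mhom Q ring_rmod (\<lambda>x. \<Sum>j\<in>J. a j * c x j)"
      using c3 by (simp add: mhom_def ring_rmod_def algebra_simps sum.distrib sum_distrib_left sum_distrib_right)
  qed
  \<comment> \<open>\<gamma> keeps the discrete component and the values at the \<open>e j\<close>;
    \<delta> rebuilds from such values a functional that agrees with the original one on
    \<open>F\<close>.\<close>
  define \<gamma> where "\<gamma> = (\<lambda>m. (fst (i m), \<lambda>j. if j \<in> J then snd (i m) (e j) else 0))"
  define \<delta> where "\<delta> = (\<lambda>(u, a). p (u, \<xi> a))"
  have im: "fst (i m) \<in> carr P" "snd (i m) \<in> carr (dual Q)" if "m \<in> carr M" for m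
    using mhom_D(1)[OF i(1) that] by (auto simp: dsum_def)
  show ?thesis
  proof (intro exI[of _ P] exI[of _ J] exI[of _ \<gamma>] exI[of _ \<delta>] conjI ballI P)
    have "mhom (dsum P (dual Q)) (dsum P (free_lmod J)) (\<lambda>(u, \<phi>). (u, \<lambda>j. if j \<in> J then \<phi> (e j) else 0))"
      using e J finite_subset[OF _ J(1)] lmodule_D[OF lP]
      by (auto simp: mhom_def dsum_def free_lmod_def fun_eq_iff)
    from mhom_comp[OF i(1) this] show "mhom M (dsum P (free_lmod J)) \<gamma>"
      by (simp add: \<gamma>_def case_prod_unfold)
    have "mhom (dsum P (free_lmod J)) (dsum P (dual Q)) (\<lambda>(u, a). (u, \<xi> a))"
      using \<xi> by (auto simp: mhom_def dsum_def free_lmod_def \<xi>_def restrict_def algebra_simps sum.distrib sum_distrib_left)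
    from mhom_comp[OF this p(1)] show "mhom (dsum P (free_lmod J)) M \<delta>"
      by (simp add: \<delta>_def case_prod_unfold)
  next
    fix m assume m: "m \<in> carr M"
    obtain u \<phi> where u: "i m = (u, \<phi>)" by (cases "i m")
    have u': "u \<in> carr P" "\<phi> \<in> carr (dual Q)" using im[OF m] u by auto
    define a where "a = (\<lambda>j. if j \<in> J then \<phi> (e j) else 0)"
    have \<delta>\<gamma>: "\<delta> (\<gamma> m) = p (u, \<xi> a)" by (simp add: \<gamma>_def \<delta>_def u a_def cong: if_cong)
    let ?\<psi> = "add (dual Q) \<phi> (smul (dual Q) (- 1) (\<xi> a))"
    have \<psi>: "?\<psi> \<in> carr (dual Q)" using lmodule_D(2,6)[OF lD] u'(2) \<xi> by blast
    have "add M m (smul M (- 1) (\<delta> (\<gamma> m))) = add M (p (u, \<phi>)) (smul M (- 1) (p (u, \<xi> a)))"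
      using bspec[OF pi m] \<delta>\<gamma> u by simp
    also have "\<dots> = p (add (dsum P (dual Q)) (u, \<phi>) (smul (dsum P (dual Q)) (- 1) (u, \<xi> a)))"
    proof -
      have t: "(u, \<phi>) \<in> carr (dsum P (dual Q))" "(u, \<xi> a) \<in> carr (dsum P (dual Q))"
        using u' \<xi> by (auto simp: dsum_def)
      show ?thesis
        using mhom_D(2)[OF p(1) t(1) lmodule_D(6)[OF lT t(2)]] mhom_D(3)[OF p(1) t(2)] by simp
    qed
    also have "add (dsum P (dual Q)) (u, \<phi>) (smul (dsum P (dual Q)) (- 1) (u, \<xi> a)) = (zer P, ?\<psi>)"
      using add_neg[OF lP u'(1)] by (simp add: dsum_def)
    also have "p (zer P, ?\<psi>) \<in> L"
    proof (rule pL[OF \<psi>])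
      fix x assume x: "x \<in> F"
      then have xQ: "x \<in> carr Q" using F(2) by blast
      have "\<phi> x = (\<Sum>j | c x j \<noteq> 0. \<phi> (e j) * c x j)" using ce u'(2) xQ by blast
      also have "\<dots> = (\<Sum>j\<in>J. \<phi> (e j) * c x j)"
        by (rule sum.mono_neutral_left) (use J(1) x in \<open>auto simp: J_def\<close>)
      also have "\<dots> = \<xi> a x" using xQ by (simp add: \<xi>_def a_def)
      finally show "?\<psi> x = 0" using xQ by simp
    qed
    finally show "add M m (smul M (- 1) (\<delta> (\<gamma> m))) \<in> L" .
  next
    \<comment> \<open>The kernel of \<gamma> is cut out by a condition on the discrete component and
      by the values at the finitely many \<open>e j\<close> with \<open>j\<close> in
      \<open>J\<close>.\<close>
    have "openin (model_top P Q) {(u, \<phi>). u = zer P \<and> \<phi> \<in> carr (dual Q) \<and> (\<forall>j\<in>J. \<phi> (e j) = 0)}"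
      unfolding openin_model_top
      using lmodule_D(1)[OF lP] J e by (auto intro!: exI[of _ "e ` J"])
    from openin_continuous_map_preimage[OF i(2) this]
    show "openin \<tau> {m \<in> carr M. \<gamma> m = zer (dsum P (free_lmod J))}"
    proof (rule back_subst[of "openin \<tau>"], intro Collect_cong)
      fix m
      show "(m \<in> topspace \<tau> \<and> i m \<in> {(u, \<phi>). u = zer P \<and> \<phi> \<in> carr (dual Q) \<and> (\<forall>j\<in>J. \<phi> (e j) = 0)}) =
        (m \<in> carr M \<and> \<gamma> m = zer (dsum P (free_lmod J)))"
        using im[of m] by (cases "i m") (auto simp: top \<gamma>_def dsum_def free_lmod_def fun_eq_iff)
    qed
  qed
qed

text \<open>An element of \<open>L\<close> is the sum of its images under \<rho> and \<theta>. The
  image under \<theta> is a combination of images of the relations \<open>E\<close>; the image under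
  \<rho> is controlled by finitely many generators of a larger lattice modulo a small open
  submodule.\<close>

lemma bounded_quotient_lattice:
  fixes M :: "('r::ring_1, 'm) lmod" and M0 :: "('r, 'a) lmod"
  assumes ap: "almost_projective2 TYPE('p) TYPE('f) M0"
    and tate: "tate TYPE('p2) TYPE('q2) M \<tau>"
    and L: "submodule L M" "openin \<tau> L" and bd: "bounded_in M \<tau> L" and quot: "quotient_rep M L M0"
  shows "lattice_in M \<tau> L"
proof -
  have M: "lmodule M" using tate by (simp add: tate_def)
  obtain q where q: "mhom M M0 q" "q ` carr M = carr M0" and qL: "{x \<in> carr M. q x = zer M0} = L"
    using quot unfolding quotient_rep_def by blast
  obtain P0 :: "('r, 'p) lmod" and F :: "('r, 'f) lmod" where
    M0: "lmodule M0" and P0: "lprojective P0" and F: "fin_pres F" and sm: "summand M0 (dsum P0 F)"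
    using ap unfolding almost_projective2_def by blast
  obtain i p where ip: "mhom M0 (dsum P0 F) i" "mhom (dsum P0 F) M0 p" "\<forall>x\<in>carr M0. p (i x) = x"
    using sm unfolding summand_def by blast
  have lF: "lmodule F" using F by (simp add: fin_pres_def)
  obtain n f E where f: "mhom (free_lmod {..<n::nat}) F f" "f ` carr (free_lmod {..<n}) = carr F"
    and E: "finite E" "E \<subseteq> carr (free_lmod {..<n})"
      "span (free_lmod {..<n}) E = {x \<in> carr (free_lmod {..<n}). f x = zer F}"
    using F unfolding fin_pres_def by blast
  let ?R = "free_lmod {..<n} :: ('r, nat \<Rightarrow> 'r) lmod"
  let ?P2 = "dsum P0 ?R" and ?X = "dsum P0 F"
  have lP0: "lmodule P0" using P0 by (simp add: lprojective_def)
  have lX: "lmodule ?X" by (rule lmodule_dsum[OF lP0 lF])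
  have lP2: "lmodule ?P2" by (rule lmodule_dsum[OF lP0 lmodule_free_lmod])
  \<comment> \<open>Identity on \<open>P0\<close> and the finite presentation over \<open>F\<close>,
    so the kernel consists of the pairs \<open>(zer P0, a)\<close> with \<open>a\<close> in the span
    of \<open>E\<close>.\<close>
  define \<pi> where "\<pi> = (\<lambda>(u, a). (u, f a) :: 'p \<times> 'f)"
  have \<pi>: "mhom ?P2 ?X \<pi>"
    using mhom_D[OF f(1)] by (auto simp: mhom_def dsum_def \<pi>_def)
  have \<pi>s: "carr ?X \<subseteq> \<pi> ` carr ?P2"
  proof
    fix x assume "x \<in> carr ?X"
    then obtain u y where x: "x = (u, y)" "u \<in> carr P0" "y \<in> f ` carr ?R"
      using f(2) by (auto simp: dsum_def)
    from x(3) obtain a where "y = f a" "a \<in> carr ?R" by blast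
    with x(1,2) show "x \<in> \<pi> ` carr ?P2" by (auto simp: \<pi>_def dsum_def intro!: image_eqI[of _ _ "(u, a)"])
  qed
  from tate_factor[OF tate L]
  obtain P :: "('r, 'p2) lmod" and J :: "'q2 set" and \<gamma> \<delta> where P: "lprojective P" and
    \<gamma>: "mhom M (dsum P (free_lmod J)) \<gamma>" and \<delta>: "mhom (dsum P (free_lmod J)) M \<delta>" and
    \<gamma>\<delta>: "\<forall>m\<in>carr M. add M m (smul M (- 1) (\<delta> (\<gamma> m))) \<in> L" and
    open\<gamma>: "openin \<tau> {m \<in> carr M. \<gamma> m = zer (dsum P (free_lmod J))}"
    by (elim exE conjE)
  let ?P1 = "dsum P (free_lmod J)"
  have lP1: "lmodule ?P1" using P by (intro lmodule_dsum lmodule_free_lmod) (simp add: lprojective_def)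
  have zero_if: "x = y" if "x \<in> carr K" "y \<in> carr K" "add K x (smul K (- 1) y) = zer K" "lmodule K"
    for x y and K :: "('r, 'a) lmod"
  proof -
    note D = lmodule_D[OF that(4)]
    have ny: "smul K (- 1) y \<in> carr K" using D(6) that(2) by blast
    have "x = add K x (add K (smul K (- 1) y) y)"
      using add_neg[OF that(4,2)] D(4)[OF ny that(2)] add_zer_right[OF that(4,1)] by simp
    also have "\<dots> = add K (zer K) y" using D(3)[OF that(1) ny that(2)] that(3) by simp
    finally show ?thesis using D(5)[OF that(2)] by simp
  qed
  \<comment> \<open>The difference of \<open>m\<close> and \<open>\<delta> (\<gamma> m)\<close> lies
    in \<open>L\<close>, the kernel of \<open>q\<close>.\<close>
  have q\<delta>\<gamma>: "q (\<delta> (\<gamma> m)) = q m" if m: "m \<in> carr M" for m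
  proof -
    have d: "\<delta> (\<gamma> m) \<in> carr M" using mhom_D(1)[OF \<gamma> m] mhom_D(1)[OF \<delta>] by blast
    have "q (add M m (smul M (- 1) (\<delta> (\<gamma> m)))) = zer M0" using \<gamma>\<delta> m qL by blast
    then have "add M0 (q m) (smul M0 (- 1) (q (\<delta> (\<gamma> m)))) = zer M0"
      using mhom_D(2)[OF q(1) m lmodule_D(6)[OF M d]] mhom_D(3)[OF q(1) d] by simp
    from zero_if[OF mhom_D(1)[OF q(1) m] mhom_D(1)[OF q(1) d] this M0] show ?thesis by simp
  qed
  \<comment> \<open>Two liftings: \<alpha> lifts \<open>i \<circ> q \<circ> \<delta>\<close> through
    \<pi>, and \<beta> lifts \<open>p \<circ> \<pi>\<close> through \<open>q\<close>. Since
    \<open>p\<close> inverts \<open>i\<close> on \<open>M0\<close>, the composite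
    \<open>\<beta> \<circ> \<alpha> \<circ> \<gamma>\<close> preserves \<open>q\<close>.\<close>
  have "mhom ?P1 ?X (\<lambda>t. i (q (\<delta> t)))"
    by (rule mhom_comp[OF mhom_comp[OF \<delta> q(1)] ip(1)])
  then obtain \<alpha> where \<alpha>: "mhom ?P1 ?P2 \<alpha>" "\<forall>t\<in>carr ?P1. \<pi> (\<alpha> t) = i (q (\<delta> t))"
    using lprojective_dsum_free_lift[OF P lX lP2 _ \<pi> \<pi>s] by blast
  have "mhom ?P2 M0 (\<lambda>t. p (\<pi> t))" by (rule mhom_comp[OF \<pi> ip(2)])
  then obtain \<beta> where \<beta>: "mhom ?P2 M \<beta>" "\<forall>t\<in>carr ?P2. q (\<beta> t) = p (\<pi> t)"
    using lprojective_dsum_free_lift[OF P0 M0 M _ q(1)] q(2) by blast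
  define \<theta> where "\<theta> m = \<beta> (\<alpha> (\<gamma> m))" for m
  have \<theta>: "mhom M M \<theta>"
    unfolding \<theta>_def by (rule mhom_comp[OF mhom_comp[OF \<gamma> \<alpha>(1)] \<beta>(1)])
  have q\<theta>: "q (\<theta> m) = q m" if m: "m \<in> carr M" for m
  proof -
    have g: "\<gamma> m \<in> carr ?P1" by (rule mhom_D(1)[OF \<gamma> m])
    have "q (\<theta> m) = p (i (q (\<delta> (\<gamma> m))))"
      using \<beta>(2) \<alpha>(2) g mhom_D(1)[OF \<alpha>(1) g] by (simp add: \<theta>_def)
    then show ?thesis using q\<delta>\<gamma>[OF m] ip(3) mhom_D(1)[OF q(1) m] by simp
  qed
  define \<rho> where "\<rho> m = add M m (smul M (- 1) (\<theta> m))" for m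
  have \<rho>: "mhom M M \<rho>"
    unfolding mhom_def
  proof (intro conjI ballI allI)
    note D = lmodule_D[OF M] and T = mhom_D[OF \<theta>]
    fix x r assume x: "x \<in> carr M"
    show "\<rho> x \<in> carr M" using x D(2,6) T(1) by (simp add: \<rho>_def)
    have "smul M (- 1) (smul M r (\<theta> x)) = smul M r (smul M (- 1) (\<theta> x))"
      using D(9)[OF T(1)[OF x], of "- 1" r] D(9)[OF T(1)[OF x], of r "- 1"] by simp
    then show "\<rho> (smul M r x) = smul M r (\<rho> x)"
      using x D(6,7) T(1,3) by (simp add: \<rho>_def)
    fix y assume y: "y \<in> carr M"
    show "\<rho> (add M x y) = add M (\<rho> x) (\<rho> y)"
      using x y D(2,6,7) T(1,2) add_swap[OF M] by (simp add: \<rho>_def)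
  qed
  have \<rho>L: "\<rho> m \<in> L" if m: "m \<in> carr M" for m
  proof -
    have t: "\<theta> m \<in> carr M" by (rule mhom_D(1)[OF \<theta> m])
    have "q (\<rho> m) = add M0 (q m) (smul M0 (- 1) (q m))"
      using mhom_D(2)[OF q(1) m lmodule_D(6)[OF M t]] mhom_D(3)[OF q(1) t] q\<theta>[OF m] by (simp add: \<rho>_def)
    also have "\<dots> = zer M0" by (rule add_neg[OF M0 mhom_D(1)[OF q(1) m]])
    finally show ?thesis using qL mhom_D(1)[OF \<rho> m] by blast
  qed
  have split: "m = add M (\<rho> m) (\<theta> m)" if m: "m \<in> carr M" for m
  proof -
    note D = lmodule_D[OF M]
    have t: "\<theta> m \<in> carr M" by (rule mhom_D(1)[OF \<theta> m])
    have nt: "smul M (- 1) (\<theta> m) \<in> carr M" by (rule D(6)[OF t])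
    have "add M (\<rho> m) (\<theta> m) = add M m (add M (smul M (- 1) (\<theta> m)) (\<theta> m))"
      unfolding \<rho>_def by (rule D(3)[OF m nt t])
    also have "\<dots> = m" using add_neg[OF M t] D(4)[OF nt t] add_zer_right[OF M m] by simp
    finally show ?thesis by simp
  qed
  have zE: "(zer P0, a) \<in> carr ?P2" if "a \<in> carr ?R" for a
    using that lmodule_D(1)[OF lP0] by (simp add: dsum_def)
  \<comment> \<open>For \<open>m\<close> in \<open>L\<close> the element
    \<open>\<alpha> (\<gamma> m)\<close> lies in the kernel of \<pi>, hence comes from the
    relations.\<close>
  have kerE: "\<exists>a. a \<in> span ?R E \<and> \<theta> m = \<beta> (zer P0, a)" if m: "m \<in> L" for m
  proof -
    have mM: "m \<in> carr M" and qm: "q m = zer M0" using m qL by auto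
    have g: "\<gamma> m \<in> carr ?P1" by (rule mhom_D(1)[OF \<gamma> mM])
    have a: "\<alpha> (\<gamma> m) \<in> carr ?P2" by (rule mhom_D(1)[OF \<alpha>(1) g])
    have "\<pi> (\<alpha> (\<gamma> m)) = zer ?X" using \<alpha>(2) g q\<delta>\<gamma>[OF mM] qm mhom_zer[OF M0 lX ip(1)] by simp
    then obtain b where "\<alpha> (\<gamma> m) = (zer P0, b)" "f b = zer F" "b \<in> carr ?R"
      using a by (cases "\<alpha> (\<gamma> m)") (auto simp: \<pi>_def dsum_def)
    then show ?thesis using E(3) by (auto simp: \<theta>_def)
  qed
  have \<beta>E: "\<beta> (zer P0, a) \<in> L" if "a \<in> E" for a
  proof -
    have a: "a \<in> carr ?R" "f a = zer F" using that E(2,3) span_superset[of E ?R] by blast+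
    have "q (\<beta> (zer P0, a)) = p (zer ?X)" using \<beta>(2) zE[OF a(1)] a(2) by (simp add: \<pi>_def dsum_def)
    then have "q (\<beta> (zer P0, a)) = zer M0" using mhom_zer[OF lX M0 ip(2)] by simp
    then show ?thesis using qL mhom_D(1)[OF \<beta>(1) zE[OF a(1)]] by blast
  qed
  obtain L' where L': "lattice_in M \<tau> L'" "L \<subseteq> L'" using bd unfolding bounded_in_def by blast
  \<comment> \<open>\<theta> factors through \<gamma>, so it vanishes on this kernel and \<rho> is
    the identity there.\<close>
  let ?K = "{m \<in> carr M. \<gamma> m = zer ?P1}"
  have subK: "submodule ?K M"
    using submodule_vimage[OF M lP1 \<gamma> submodule_zer[OF lP1]] by simp
  have \<rho>K: "\<rho> m = m" if "m \<in> ?K" for m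
  proof -
    have "\<theta> m = zer M" using that mhom_zer[OF lP1 lP2 \<alpha>(1)] mhom_zer[OF lP2 M \<beta>(1)] by (simp add: \<theta>_def)
    then show ?thesis using that smul_zer[OF M] add_zer_right[OF M] by (simp add: \<rho>_def)
  qed
  show ?thesis
    unfolding lattice_in_def
  proof (intro conjI allI impI L)
    fix U assume U: "submodule U M \<and> openin \<tau> U \<and> U \<subseteq> L"
    \<comment> \<open>The lattice \<open>L'\<close> is tested on \<open>U \<inter> ?K\<close>
      because \<rho> fixes this set pointwise and therefore keeps it inside
      \<open>U\<close>.\<close>
    have "submodule (U \<inter> ?K) M" "openin \<tau> (U \<inter> ?K)" "U \<inter> ?K \<subseteq> L'"
      using U subK open\<gamma> L'(2) by (auto intro: submodule_Int openin_Int)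
    then obtain G where G: "finite G" "G \<subseteq> L'" "span M (G \<union> (U \<inter> ?K)) = L'"
      using L'(1) unfolding lattice_in_def by blast
    have L'M: "L' \<subseteq> carr M" using L'(1) by (simp add: lattice_in_def submodule_def)
    let ?S = "\<rho> ` G \<union> (\<lambda>a. \<beta> (zer P0, a)) ` E"
    have S: "?S \<subseteq> L" using \<rho>L G(2) L'M \<beta>E by blast
    have "span M (?S \<union> U) = L"
    proof (rule antisym)
      show "span M (?S \<union> U) \<subseteq> L" by (rule span_subset[OF L(1)]) (use S U in blast)
      show "L \<subseteq> span M (?S \<union> U)"
        unfolding span_def
      proof (intro subsetI InterI, elim CollectE conjE)
        fix m Y assume m: "m \<in> L" and Y: "submodule Y M" "?S \<union> U \<subseteq> Y"
        have mM: "m \<in> carr M" using m qL by blast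
        \<comment> \<open>The preimage of \<open>Y\<close> under \<rho> is a submodule containing
          \<open>G\<close> and \<open>U \<inter> ?K\<close>, so it contains \<open>L'\<close> and
          with it \<open>m\<close>.\<close>
        have "span M (G \<union> (U \<inter> ?K)) \<subseteq> {x \<in> carr M. \<rho> x \<in> Y}"
          by (rule span_subset[OF submodule_vimage[OF M M \<rho> Y(1)]]) (use G(2) L'M Y(2) \<rho>K in auto)
        then have "\<rho> m \<in> Y" using m L'(2) G(3) by blast
        moreover have "span ?R E \<subseteq> {a \<in> carr ?R. \<beta> (zer P0, a) \<in> Y}"
        proof (rule span_subset[OF submodule_vimage[OF lmodule_free_lmod M _ Y(1)]])
          have "mhom ?R ?P2 (\<lambda>a. (zer P0, a))"
            using lmodule_D(1)[OF lP0] lmodule_D(5)[OF lP0] smul_zer[OF lP0]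
            by (simp add: mhom_def dsum_def)
          from mhom_comp[OF this \<beta>(1)] show "mhom ?R M (\<lambda>a. \<beta> (zer P0, a))" .
        qed (use E(2) Y(2) in auto)
        then have "\<theta> m \<in> Y" using kerE[OF m] by auto
        ultimately have "add M (\<rho> m) (\<theta> m) \<in> Y" using Y(1) by (simp add: submodule_def)
        then show "m \<in> Y" using split[OF mM] by simp
      qed
    qed
    then show "\<exists>S. finite S \<and> S \<subseteq> L \<and> span M (S \<union> U) = L"
      using S G(1) E(1) by (intro exI[of _ ?S]) simp
  qed
qed

section \<open>The Tate module of a lifted idempotent\<close>

definition fscale :: "'r::ring_1 \<Rightarrow> ('i \<Rightarrow> 'r) \<Rightarrow> 'i \<Rightarrow> 'r" where
  "fscale r x = (\<lambda>i. r * x i)"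

text \<open>The operations do not depend on the index set, so elements of free modules on different
  subsets of one type can be combined directly.\<close>

lemma free_lmod_simps:
  "add (free_lmod I) x y = x + y" "zer (free_lmod I) = 0" "smul (free_lmod I) r x = fscale r x"
  by (simp_all add: free_lmod_def fscale_def fun_eq_iff)

lemma fscale_simps:
  "fscale r (x + y) = fscale r x + fscale r y" "fscale r (x - y) = fscale r x - fscale r y"
  "fscale r 0 = 0" "fscale (- 1) x = - x"
  by (simp_all add: fscale_def fun_eq_iff algebra_simps)

lemma free_lmod_closed:
  assumes "x \<in> carr (free_lmod I)"
  shows "y \<in> carr (free_lmod I) \<Longrightarrow> x + y \<in> carr (free_lmod I)"
    "y \<in> carr (free_lmod I) \<Longrightarrow> x - y \<in> carr (free_lmod I)"
    "fscale r x \<in> carr (free_lmod I)"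
proof -
  note D = lmodule_D[OF lmodule_free_lmod[of I], unfolded free_lmod_simps]
  show "x + y \<in> carr (free_lmod I)" if "y \<in> carr (free_lmod I)" using D(2)[OF assms that] .
  show "fscale r x \<in> carr (free_lmod I)" using D(6)[OF assms] .
  show "x - y \<in> carr (free_lmod I)" if "y \<in> carr (free_lmod I)"
    using D(2)[OF assms D(6)[OF that, of "- 1"]] by (simp add: fscale_simps)
qed

lemma zero_in_free_lmod: "0 \<in> carr (free_lmod I)"
  using lmodule_D(1)[OF lmodule_free_lmod[of I]] by (simp add: free_lmod_simps)

lemma free_lmod_mono: "S \<subseteq> J \<Longrightarrow> x \<in> carr (free_lmod S) \<Longrightarrow> x \<in> carr (free_lmod J)"
  by (auto simp: free_lmod_def)

text \<open>The situation to which part (a) is reduced: \<open>eps\<close> lifts an idempotent, so it is idempotent only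
  up to the finitely generated free module on \<open>S\<close>.  The map \<open>enc\<close> encodes sequences of elements of
  the free module on \<open>J\<close> as functions on the single index type \<open>'i\<close>.\<close>

locale almost_split =
  fixes J S :: "'i set" and eps :: "('i \<Rightarrow> 'r::ring_1) \<Rightarrow> 'i \<Rightarrow> 'r"
    and q :: "('i \<Rightarrow> 'r) \<Rightarrow> 'a" and M0 :: "('r, 'a) lmod" and enc :: "nat \<Rightarrow> 'i \<Rightarrow> 'i"
  assumes finS: "finite S" and SJ: "S \<subseteq> J"
    and eps: "mhom (free_lmod J) (free_lmod J) eps"
    and M0: "lmodule M0"
    and q: "mhom (free_lmod J) M0 q" "q ` carr (free_lmod J) = carr M0"
    and q_eps: "\<And>x. x \<in> carr (free_lmod J) \<Longrightarrow> q (eps x) = q x"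
    and eps_ker: "\<And>x. x \<in> carr (free_lmod J) \<Longrightarrow> q x = zer M0 \<Longrightarrow> eps x \<in> carr (free_lmod S)"
    and enc: "inj_on (\<lambda>(k, j). enc k j) (UNIV \<times> J)"
begin

abbreviation P where "P \<equiv> carr (free_lmod J :: ('r, 'i \<Rightarrow> 'r) lmod)"
abbreviation C where "C \<equiv> carr (free_lmod S :: ('r, 'i \<Rightarrow> 'r) lmod)"

lemma C_P: "x \<in> C \<Longrightarrow> x \<in> P"
  using SJ free_lmod_mono by blast

lemmas P_closed = free_lmod_closed[of _ J] and C_closed = free_lmod_closed[of _ S]

lemma eps_P: "x \<in> P \<Longrightarrow> eps x \<in> P"
  using mhom_D(1)[OF eps] .

lemma eps_add: "x \<in> P \<Longrightarrow> y \<in> P \<Longrightarrow> eps (x + y) = eps x + eps y"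
  using mhom_D(2)[OF eps, of x y] by (simp add: free_lmod_simps)

lemma eps_scale: "x \<in> P \<Longrightarrow> eps (fscale r x) = fscale r (eps x)"
  using mhom_D(3)[OF eps, of x r] by (simp add: free_lmod_simps)

lemma eps_diff: "x \<in> P \<Longrightarrow> y \<in> P \<Longrightarrow> eps (x - y) = eps x - eps y"
  using eps_add[of x "fscale (- 1) y"] eps_scale[of y "- 1"] P_closed(3)[of y "- 1"]
  by (simp add: fscale_simps)

section \<open>Recovering a sequence from its defects and boundaries\<close>

definition defect :: "('i \<Rightarrow> 'r) \<Rightarrow> 'i \<Rightarrow> 'r" where
  "defect x = eps x - eps (eps x)"

text \<open>By \<open>q_eps\<close> the element \<open>x - eps x\<close> is in the kernel of
  \<open>q\<close>, and \<open>eps\<close> maps that kernel into \<open>C\<close>.\<close>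

lemma defect_C:
  assumes "x \<in> P"
  shows "defect x \<in> C"
proof -
  have d: "x - eps x \<in> P" using assms P_closed eps_P by blast
  have "q (x + fscale (- 1) (eps x)) = add M0 (q x) (smul M0 (- 1) (q (eps x)))"
    using mhom_D(2)[OF q(1), of x "fscale (- 1) (eps x)"] mhom_D(3)[OF q(1), of "eps x" "- 1"]
      assms eps_P[OF assms] P_closed(3)[OF eps_P[OF assms], of "- 1"] by (simp add: free_lmod_simps)
  then have "q (x - eps x) = zer M0"
    using q_eps[OF assms] add_neg[OF M0 mhom_D(1)[OF q(1) assms]] by (simp add: fscale_simps)
  from eps_ker[OF d this] show ?thesis
    using eps_diff[of x "eps x"] assms eps_P by (simp add: defect_def)
qed

definition boundary :: "(nat \<Rightarrow> 'i \<Rightarrow> 'r) \<Rightarrow> nat \<Rightarrow> 'i \<Rightarrow> 'r" where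
  "boundary x k = x k - eps (x k) + eps (x (Suc k))"

definition admissible :: "(nat \<Rightarrow> 'i \<Rightarrow> 'r) \<Rightarrow> bool" where
  "admissible x \<longleftrightarrow> (\<forall>k. x k \<in> P \<and> boundary x k \<in> C)"

text \<open>On admissible sequences \<open>x = eps x + (1 - eps) x\<close>, and both summands can be expressed by \<open>eps (x 0)\<close>,
  \<open>defect x\<close> and \<open>boundary x\<close>; this gives the formulas below.\<close>

fun recon :: "('i \<Rightarrow> 'r) \<Rightarrow> (nat \<Rightarrow> 'i \<Rightarrow> 'r) \<Rightarrow> (nat \<Rightarrow> 'i \<Rightarrow> 'r) \<Rightarrow> nat \<Rightarrow> 'i \<Rightarrow> 'r" where
  "recon y g b 0 = y + g 0 - g 1 + (b 0 - eps (b 0))"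
| "recon y g b (Suc k) =
     g (Suc k) + g (Suc k) - g k - g (Suc (Suc k)) + eps (b k) + (b (Suc k) - eps (b (Suc k)))"

definition project :: "(nat \<Rightarrow> 'i \<Rightarrow> 'r) \<Rightarrow> (nat \<Rightarrow> 'i \<Rightarrow> 'r) \<Rightarrow> nat \<Rightarrow> 'i \<Rightarrow> 'r" where
  "project x b = recon (eps (x 0)) (\<lambda>k. defect (x k)) b"

lemma recon_P:
  "y \<in> P \<Longrightarrow> (\<And>k. g k \<in> P) \<Longrightarrow> (\<And>k. b k \<in> P) \<Longrightarrow> recon y g b k \<in> P"
  by (cases k) (simp_all add: P_closed eps_P)

lemma project_P: "(\<And>k. x k \<in> P) \<Longrightarrow> (\<And>k. b k \<in> P) \<Longrightarrow> project x b k \<in> P"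
  unfolding project_def by (rule recon_P) (simp_all add: P_closed eps_P defect_C C_P)

text \<open>Applied to arbitrary \<open>g\<close>, \<open>recon\<close> need not be admissible, but with \<open>g = defect x\<close> it is, because
  \<open>eps (defect x) = defect (eps x)\<close> lies again in \<open>C\<close>.  Hence \<open>ret\<close> below uses \<open>recon\<close> twice.\<close>

lemma project_admissible:
  assumes x: "\<And>k. x k \<in> P" and b: "\<And>k. b k \<in> C"
  shows "admissible (project x b)"
  unfolding admissible_def
proof (intro allI conjI)
  note bP = C_P[OF b]
  let ?F = "\<lambda>k. defect (x k)" and ?G = "\<lambda>k. defect (eps (x k))"
  fix k
  show "project x b k \<in> P" by (rule project_P[OF x bP])
  show "boundary (project x b) k \<in> C"
  proof (cases k)
    case 0
    \<comment> \<open>Every term on the right lies in \<open>C\<close>. The term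
      \<open>eps (x 0)\<close> contributes only its defect, and the two terms in \<open>b 0\<close>
      combine by \<open>(1 - eps)^2 + eps^2 = 1 - 2 (eps - eps^2)\<close>.\<close>
    have "boundary (project x b) 0 = ?F 0 + ?F 0 - ?F 1 - ?G 0 - ?G 0 + ?G 1 + ?G 1 + ?G 1 - ?G 2
       + b 0 - defect (b 0) - defect (b 0) + defect (b 1)"
      by (simp add: boundary_def project_def defect_def numeral_2_eq_2 x bP eps_add eps_diff P_closed eps_P)
    then show ?thesis using 0 x b bP by (simp add: C_closed defect_C eps_P)
  next
    case (Suc n)
    have "boundary (project x b) (Suc n) = ?F (Suc n) + ?F (Suc n) - ?F n - ?F (Suc (Suc n))
       + ?G n - ?G (Suc n) - ?G (Suc n) - ?G (Suc n)
       + ?G (Suc (Suc n)) + ?G (Suc (Suc n)) + ?G (Suc (Suc n)) - ?G (Suc (Suc (Suc n)))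
       + defect (b n) + b (Suc n) - defect (b (Suc n)) - defect (b (Suc n)) + defect (b (Suc (Suc n)))"
      by (simp add: boundary_def project_def defect_def x bP eps_add eps_diff P_closed eps_P)
    then show ?thesis using Suc x b bP by (simp add: C_closed defect_C eps_P)
  qed
qed

text \<open>Applying \<open>1 - eps\<close> to \<open>boundary x k\<close> gives
  \<open>x k - eps (x k) - defect (x k) + defect (x (Suc k))\<close>, and applying
  \<open>eps\<close> gives \<open>eps (x (Suc k)) + defect (x k) - defect (x (Suc k))\<close>.
  Solving for both parts of each entry yields the formulas of \<open>recon\<close>; only
  \<open>eps (x 0)\<close> has to be supplied.\<close>

lemma project_boundary:
  assumes "admissible x"
  shows "project x (boundary x) = x"
proof
  have x: "x k \<in> P" for k using assms by (simp add: admissible_def)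
  fix k show "project x (boundary x) k = x k"
    by (cases k) (simp_all add: project_def boundary_def defect_def x eps_add eps_diff P_closed eps_P)
qed

section \<open>Coding sequences as functions on one index type\<close>

definition decode :: "nat \<Rightarrow> ('i \<Rightarrow> 'r) \<Rightarrow> 'i \<Rightarrow> 'r" where
  "decode k m = (\<lambda>j. if j \<in> J then m (enc k j) else 0)"

definition encode :: "(nat \<Rightarrow> 'i \<Rightarrow> 'r) \<Rightarrow> 'i \<Rightarrow> 'r" where
  "encode x = (\<lambda>i. if i \<in> (\<lambda>(k, j). enc k j) ` (UNIV \<times> J)
     then case inv_into (UNIV \<times> J) (\<lambda>(k, j). enc k j) i of (k, j) \<Rightarrow> x k j else 0)"

lemma encode_enc: "j \<in> J \<Longrightarrow> encode x (enc k j) = x k j"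
  using inv_into_f_f[OF enc, of "(k, j)"] by (force simp: encode_def)

lemma encode_outside: "i \<notin> (\<lambda>(k, j). enc k j) ` (UNIV \<times> J) \<Longrightarrow> encode x i = 0"
  unfolding encode_def by simp

lemma decode_encode:
  assumes "x k \<in> P"
  shows "decode k (encode x) = x k"
  using assms by (auto simp: decode_def encode_enc free_lmod_def)

lemma encode_decode:
  assumes "\<And>i. i \<notin> (\<lambda>(k, j). enc k j) ` (UNIV \<times> J) \<Longrightarrow> m i = 0"
  shows "encode (\<lambda>k. decode k m) = m"
proof
  fix i show "encode (\<lambda>k. decode k m) i = m i"
  proof (cases "i \<in> (\<lambda>(k, j). enc k j) ` (UNIV \<times> J)")
    case True
    then obtain k j where "i = enc k j" "j \<in> J" by auto
    then show ?thesis by (simp add: encode_enc decode_def)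
  qed (simp add: assms encode_outside)
qed

lemma decode_linear:
  "decode k (m + n) = decode k m + decode k n" "decode k (fscale r m) = fscale r (decode k m)"
  "decode k 0 = 0"
  by (auto simp: decode_def fscale_def)

lemma encode_linear:
  "encode (\<lambda>k. x k + y k) = encode x + encode y" "encode (\<lambda>k. fscale r (x k)) = fscale r (encode x)"
  by (auto simp: encode_def fscale_def split: prod.splits)

text \<open>Vanishing at the indices that code no pair makes the code of a sequence unique, so that
  \<open>encode\<close> inverts \<open>decode\<close> on this carrier.\<close>

definition Mod :: "('r, 'i \<Rightarrow> 'r) lmod" where
  "Mod = \<lparr> carr = {m. (\<forall>i. i \<notin> (\<lambda>(k, j). enc k j) ` (UNIV \<times> J) \<longrightarrow> m i = 0) \<and> admissible (\<lambda>k. decode k m)},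
     add = (+), zer = 0, smul = fscale \<rparr>"

lemma Mod_simps [simp]: "add Mod = (+)" "zer Mod = 0" "smul Mod = fscale"
  by (simp_all add: Mod_def)

lemma defect_linear:
  "x \<in> P \<Longrightarrow> y \<in> P \<Longrightarrow> defect (x + y) = defect x + defect y"
  "x \<in> P \<Longrightarrow> defect (fscale r x) = fscale r (defect x)"
  by (simp_all add: defect_def eps_add eps_scale eps_P fscale_simps)

lemma boundary_linear:
  "(\<And>k. x k \<in> P) \<Longrightarrow> (\<And>k. y k \<in> P) \<Longrightarrow> boundary (\<lambda>k. x k + y k) k = boundary x k + boundary y k"
  "(\<And>k. x k \<in> P) \<Longrightarrow> boundary (\<lambda>k. fscale r (x k)) k = fscale r (boundary x k)"
  by (simp_all add: boundary_def eps_add eps_scale eps_P fscale_simps)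

lemma recon_linear:
  "(\<And>k. b k \<in> P) \<Longrightarrow> (\<And>k. b' k \<in> P) \<Longrightarrow>
     recon (y + y') (\<lambda>k. g k + g' k) (\<lambda>k. b k + b' k) k = recon y g b k + recon y' g' b' k"
  "(\<And>k. b k \<in> P) \<Longrightarrow> recon (fscale r y) (\<lambda>k. fscale r (g k)) (\<lambda>k. fscale r (b k)) k = fscale r (recon y g b k)"
  by (cases k; simp add: eps_add eps_scale eps_P fscale_simps)+

lemma project_linear:
  "(\<And>k. x k \<in> P) \<Longrightarrow> (\<And>k. x' k \<in> P) \<Longrightarrow> (\<And>k. b k \<in> P) \<Longrightarrow> (\<And>k. b' k \<in> P) \<Longrightarrow>
     project (\<lambda>k. x k + x' k) (\<lambda>k. b k + b' k) k = project x b k + project x' b' k"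
  "(\<And>k. x k \<in> P) \<Longrightarrow> (\<And>k. b k \<in> P) \<Longrightarrow>
     project (\<lambda>k. fscale r (x k)) (\<lambda>k. fscale r (b k)) k = fscale r (project x b k)"
  by (simp_all add: project_def eps_add eps_scale defect_linear recon_linear)

lemma admissible_linear:
  "admissible x \<Longrightarrow> admissible y \<Longrightarrow> admissible (\<lambda>k. x k + y k)"
  "admissible x \<Longrightarrow> admissible (\<lambda>k. fscale r (x k))"
  unfolding admissible_def
  by (simp_all add: boundary_linear P_closed C_closed)

lemma eps_zero: "eps 0 = 0"
  using eps_diff[OF zero_in_free_lmod zero_in_free_lmod] by simp

lemma Mod_closed:
  "m \<in> carr Mod \<Longrightarrow> n \<in> carr Mod \<Longrightarrow> m + n \<in> carr Mod"
  "m \<in> carr Mod \<Longrightarrow> fscale r m \<in> carr Mod"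
  "0 \<in> carr Mod"
proof -
  show "m \<in> carr Mod \<Longrightarrow> n \<in> carr Mod \<Longrightarrow> m + n \<in> carr Mod"
    by (simp add: Mod_def decode_linear admissible_linear)
  show "m \<in> carr Mod \<Longrightarrow> fscale r m \<in> carr Mod"
    by (simp add: Mod_def decode_linear admissible_linear) (simp add: fscale_def)
  show "0 \<in> carr Mod"
    by (simp add: Mod_def decode_linear admissible_def boundary_def eps_zero zero_in_free_lmod)
qed

lemma lmodule_Mod: "lmodule Mod"
  unfolding lmodule_def abgrp_part_def Mod_simps
proof (intro conjI ballI allI)
  fix m assume "m \<in> carr Mod"
  then have "fscale (- 1) m \<in> carr Mod" by (rule Mod_closed)
  then show "\<exists>n\<in>carr Mod. m + n = 0" by (intro bexI[of _ "fscale (- 1) m"]) (simp_all add: fscale_simps)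
qed (auto simp: Mod_closed fscale_simps add.commute add.assoc, auto simp: fscale_def algebra_simps fun_eq_iff)

section \<open>Comparison of the module of sequences with a free module plus a dual\<close>

definition Ind :: "'i set" where
  "Ind = (\<lambda>(k, j). enc k j) ` (UNIV \<times> S)"

text \<open>Since \<open>S\<close> is finite, the dual of \<open>Q\<close> is the product of
  countably many copies of \<open>C\<close>, one for each \<open>k\<close>.\<close>

abbreviation Q where "Q \<equiv> free_rmod Ind :: ('r, 'i \<Rightarrow> 'r) lmod"

lemma rmodule_Q: "rmodule Q"
proof -
  have "rprojective Q" by (rule rprojective_free_rmod)
  then show ?thesis by (simp add: rprojective_def)
qed

text \<open>With \<open>coord\<close>, this passes between sequences in \<open>C\<close> and
  functionals on \<open>Q\<close>: for \<open>j\<close> in \<open>S\<close>, the value on the basis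
  vector at \<open>enc k j\<close> is \<open>d k j\<close>.\<close>

definition functional :: "(nat \<Rightarrow> 'i \<Rightarrow> 'r) \<Rightarrow> ('i \<Rightarrow> 'r) \<Rightarrow> 'r" where
  "functional d = restrict (\<lambda>y. \<Sum>i | y i \<noteq> 0. encode d i * y i) (carr Q)"

definition coord :: "nat \<Rightarrow> (('i \<Rightarrow> 'r) \<Rightarrow> 'r) \<Rightarrow> 'i \<Rightarrow> 'r" where
  "coord k \<phi> = (\<lambda>j. if j \<in> S then \<phi> (delta (enc k j)) else 0)"

lemma delta_Q: "j \<in> S \<Longrightarrow> delta (enc k j) \<in> carr Q"
  unfolding free_rmod_gfree by (rule delta_in_gfree) (force simp: Ind_def)

lemma functional_dual: "functional d \<in> carr (dual Q)"
  unfolding functional_def by (rule restrict_in_dual[OF rmodule_Q mhom_free_rmod_sum])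

lemma coord_C: "coord k \<phi> \<in> C"
proof -
  have "{i. coord k \<phi> i \<noteq> 0} \<subseteq> S" by (auto simp: coord_def split: if_splits)
  from finite_subset[OF this finS] show ?thesis by (simp add: free_lmod_def) (simp add: coord_def)
qed

lemma coord_functional:
  assumes "d k \<in> C"
  shows "coord k (functional d) = d k"
proof
  fix j show "coord k (functional d) j = d k j"
  proof (cases "j \<in> S")
    case True
    have "{i. delta (enc k j) i \<noteq> (0::'r)} = {enc k j}" by (auto simp: delta_def)
    then show ?thesis using True SJ delta_Q[OF True, of k]
      by (auto simp: coord_def functional_def encode_enc)
  next
    case False
    then show ?thesis using assms by (simp add: coord_def free_lmod_def)
  qed
qed

lemma coord_linear:
  "coord k (add (dual Q) \<phi> \<psi>) = coord k \<phi> + coord k \<psi>"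
  "coord k (smul (dual Q) r \<phi>) = fscale r (coord k \<phi>)"
  using delta_Q by (auto simp: coord_def fscale_def)

lemma functional_linear:
  "functional (\<lambda>k. d k + d' k) = add (dual Q) (functional d) (functional d')"
  "functional (\<lambda>k. fscale r (d k)) = smul (dual Q) r (functional d)"
  by (auto simp: functional_def encode_linear restrict_def fun_eq_iff algebra_simps
      sum.distrib sum_distrib_left fscale_def[of r "encode d"])

text \<open>Interleaves two sequences in \<open>C\<close>, so that a single dual records
  both.\<close>

definition data :: "(nat \<Rightarrow> 'i \<Rightarrow> 'r) \<Rightarrow> nat \<Rightarrow> 'i \<Rightarrow> 'r" where
  "data x n = (if even n then defect (x (n div 2)) else boundary x (n div 2))"

text \<open>The first component need not lie in \<open>C\<close> and goes into the discrete factor;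
  all the rest is a sequence in \<open>C\<close>.\<close>

definition inc :: "('i \<Rightarrow> 'r) \<Rightarrow> ('i \<Rightarrow> 'r) \<times> (('i \<Rightarrow> 'r) \<Rightarrow> 'r)" where
  "inc m = (eps (decode 0 m), functional (data (\<lambda>k. decode k m)))"

definition raw :: "('i \<Rightarrow> 'r) \<times> (('i \<Rightarrow> 'r) \<Rightarrow> 'r) \<Rightarrow> nat \<Rightarrow> 'i \<Rightarrow> 'r" where
  "raw t = recon (fst t) (\<lambda>k. coord (2 * k) (snd t)) (\<lambda>k. coord (2 * k + 1) (snd t))"

definition ret :: "('i \<Rightarrow> 'r) \<times> (('i \<Rightarrow> 'r) \<Rightarrow> 'r) \<Rightarrow> 'i \<Rightarrow> 'r" where
  "ret t = encode (project (raw t) (\<lambda>k. coord (2 * k + 1) (snd t)))"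

abbreviation T where "T \<equiv> dsum (free_lmod J) (dual Q)"

lemma lmodule_T: "lmodule T"
  by (rule lmodule_dsum[OF lmodule_free_lmod lmodule_dual[OF rmodule_Q]])

lemma decode_P: "m \<in> carr Mod \<Longrightarrow> decode k m \<in> P"
  by (simp add: Mod_def admissible_def)

lemma data_C: "m \<in> carr Mod \<Longrightarrow> data (\<lambda>k. decode k m) n \<in> C"
  using defect_C[OF decode_P] by (simp add: data_def Mod_def admissible_def)

lemma mhom_inc: "mhom Mod T inc"
  unfolding mhom_def
proof (intro conjI ballI allI)
  fix m r assume m: "m \<in> carr Mod"
  note mP = decode_P[OF m]
  show "inc m \<in> carr T" using mP eps_P functional_dual by (simp add: dsum_def inc_def)
  have "data (\<lambda>k. decode k (fscale r m)) = (\<lambda>n. fscale r (data (\<lambda>k. decode k m) n))"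
    by (auto simp: data_def decode_linear defect_linear boundary_linear mP)
  then show "inc (smul Mod r m) = smul T r (inc m)"
    using functional_linear(2)[of r "data (\<lambda>k. decode k m)"]
    by (simp add: inc_def dsum_def decode_linear eps_scale mP free_lmod_simps)
  fix n assume n: "n \<in> carr Mod"
  note nP = decode_P[OF n]
  have "data (\<lambda>k. decode k (m + n)) = (\<lambda>i. data (\<lambda>k. decode k m) i + data (\<lambda>k. decode k n) i)"
    by (auto simp: data_def decode_linear defect_linear boundary_linear mP nP)
  then show "inc (add Mod m n) = add T (inc m) (inc n)"
    using functional_linear(1)[of "data (\<lambda>k. decode k m)" "data (\<lambda>k. decode k n)"]
    by (simp add: inc_def dsum_def decode_linear eps_add mP nP free_lmod_simps)
qed

lemma raw_P: "fst t \<in> P \<Longrightarrow> raw t k \<in> P"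
  unfolding raw_def by (rule recon_P) (simp_all add: C_P coord_C)

lemma decode_ret:
  "fst t \<in> P \<Longrightarrow> decode k (ret t) = project (raw t) (\<lambda>k. coord (2 * k + 1) (snd t)) k"
  unfolding ret_def by (rule decode_encode, rule project_P) (simp_all add: raw_P C_P coord_C)

lemma ret_Mod:
  assumes "fst t \<in> P"
  shows "ret t \<in> carr Mod"
proof -
  have "admissible (project (raw t) (\<lambda>k. coord (2 * k + 1) (snd t)))"
    by (rule project_admissible) (simp_all add: raw_P assms coord_C)
  moreover have "(\<lambda>k. decode k (ret t)) = project (raw t) (\<lambda>k. coord (2 * k + 1) (snd t))"
    by (simp add: decode_ret[OF assms])
  ultimately show ?thesis
    unfolding Mod_def by (simp add: ret_def encode_outside)
qed

lemma mhom_ret: "mhom T Mod ret"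
  unfolding mhom_def
proof (intro conjI ballI allI)
  fix s r assume "s \<in> carr T"
  then have s: "fst s \<in> P" by (auto simp: dsum_def)
  show "ret s \<in> carr Mod" by (rule ret_Mod[OF s])
  have fs: "fst (smul T r s) = fscale r (fst s)" "snd (smul T r s) = smul (dual Q) r (snd s)"
    by (simp_all add: dsum_def free_lmod_simps case_prod_unfold)
  have rs: "raw (smul T r s) = (\<lambda>k. fscale r (raw s k))"
    unfolding raw_def fs coord_linear by (rule ext, rule recon_linear) (simp add: C_P coord_C)
  have "project (raw (smul T r s)) (\<lambda>k. coord (2 * k + 1) (snd (smul T r s))) =
     (\<lambda>k. fscale r (project (raw s) (\<lambda>k. coord (2 * k + 1) (snd s)) k))"
    unfolding rs fs coord_linear by (rule ext, rule project_linear) (simp_all add: raw_P s C_P coord_C)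
  then show "ret (smul T r s) = smul Mod r (ret s)" by (simp add: ret_def encode_linear)
  fix t assume "t \<in> carr T"
  then have t: "fst t \<in> P" by (auto simp: dsum_def)
  have ft: "fst (add T s t) = fst s + fst t" "snd (add T s t) = add (dual Q) (snd s) (snd t)"
    by (simp_all add: dsum_def free_lmod_simps case_prod_unfold)
  have rt: "raw (add T s t) = (\<lambda>k. raw s k + raw t k)"
    unfolding raw_def ft coord_linear by (rule ext, rule recon_linear) (simp_all add: C_P coord_C)
  have "project (raw (add T s t)) (\<lambda>k. coord (2 * k + 1) (snd (add T s t))) =
     (\<lambda>k. project (raw s) (\<lambda>k. coord (2 * k + 1) (snd s)) k + project (raw t) (\<lambda>k. coord (2 * k + 1) (snd t)) k)"
    unfolding rt ft coord_linear by (rule ext, rule project_linear) (simp_all add: raw_P s t C_P coord_C)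
  then show "ret (add T s t) = add Mod (ret s) (ret t)" by (simp add: ret_def encode_linear)
qed

text \<open>On the data of an admissible sequence \<open>raw\<close> already returns that sequence,
  and by \<open>project_boundary\<close> the second pass leaves it unchanged.\<close>

lemma ret_inc:
  assumes "m \<in> carr Mod"
  shows "ret (inc m) = m"
proof -
  let ?x = "\<lambda>k. decode k m"
  have adm: "admissible ?x" and out: "\<And>i. i \<notin> (\<lambda>(k, j). enc k j) ` (UNIV \<times> J) \<Longrightarrow> m i = 0"
    using assms by (auto simp: Mod_def)
  have g: "(\<lambda>k. coord (2 * k) (snd (inc m))) = (\<lambda>k. defect (?x k))"
    using coord_functional[of "data ?x", OF data_C[OF assms]] by (simp add: inc_def data_def)
  have b: "(\<lambda>k. coord (2 * k + 1) (snd (inc m))) = boundary ?x"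
    using coord_functional[of "data ?x", OF data_C[OF assms]] by (simp add: inc_def data_def fun_eq_iff[where 'a = nat])
  have "raw (inc m) = ?x"
    using project_boundary[OF adm] unfolding raw_def g b by (simp add: project_def inc_def)
  then have "ret (inc m) = encode ?x"
    unfolding ret_def b using project_boundary[OF adm] by simp
  then show ?thesis using encode_decode[OF out] by simp
qed

section \<open>Topology of the module of sequences\<close>

lemma recon_cong:
  assumes "\<And>n. n \<le> k + 1 \<Longrightarrow> g n = g' n" "\<And>n. n \<le> k + 1 \<Longrightarrow> b n = b' n"
  shows "recon y g b k = recon y g' b' k"
  using assms by (cases k) simp_all

text \<open>Each of the two passes looks at most one index ahead, so entry \<open>k\<close> uses
  indices up to \<open>k + 2\<close>; interleaved, these occupy positions up to
  \<open>2 * (k + 2) + 1\<close>.\<close>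

lemma ret_finite_dependence:
  assumes "fst s \<in> P" "fst t = fst s" "\<And>n. n \<le> 2 * k + 5 \<Longrightarrow> coord n (snd s) = coord n (snd t)"
  shows "decode k (ret s) = decode k (ret t)"
proof -
  have raw: "raw s n = raw t n" if "n \<le> k + 1" for n
    unfolding raw_def assms(2) by (rule recon_cong) (use assms(3) that in auto)
  have b: "coord (2 * n + 1) (snd s) = coord (2 * n + 1) (snd t)" if "n \<le> k + 1" for n
    using assms(3)[of "2 * n + 1"] that by simp
  have "project (raw s) (\<lambda>k. coord (2 * k + 1) (snd s)) k = project (raw t) (\<lambda>k. coord (2 * k + 1) (snd t)) k"
    unfolding project_def raw[of 0, simplified] by (rule recon_cong) (simp_all only: raw b)
  then show ?thesis using decode_ret[of s k] decode_ret[of t k] assms(1,2) by simp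
qed

text \<open>The topology induced by the embedding \<open>inc\<close>, which makes \<open>inc\<close>
  continuous by construction.\<close>

definition mod_top :: "('i \<Rightarrow> 'r) topology" where
  "mod_top = pullback_topology (carr Mod) inc (model_top (free_lmod J) Q)"

lemma topspace_mod_top: "topspace mod_top = carr Mod"
  using mhom_D(1)[OF mhom_inc] by (auto simp: mod_top_def topspace_pullback_topology topspace_model_top)

lemma continuous_inc: "continuous_map mod_top (model_top (free_lmod J) Q) inc"
proof -
  have "continuous_map mod_top (model_top (free_lmod J) Q) (id \<circ> inc)"
    unfolding mod_top_def by (rule continuous_map_pullback[OF continuous_map_id])
  then show ?thesis by simp
qed

text \<open>For the induced topology it suffices that \<open>inc \<circ> ret\<close> is continuous.
  This holds because finitely many coordinates of its value depend on the discrete component and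
  finitely many coordinates of the argument.\<close>

lemma continuous_ret: "continuous_map (model_top (free_lmod J) Q) mod_top ret"
  unfolding mod_top_def
proof (rule continuous_map_pullback')
  let ?X = "model_top (free_lmod J) Q"
  have Tc: "(u, \<phi>) \<in> carr T \<longleftrightarrow> u \<in> P \<and> \<phi> \<in> carr (dual Q)" for u \<phi> by (simp add: dsum_def)
  show "topspace ?X \<subseteq> ret -` carr Mod"
    using mhom_D(1)[OF mhom_ret] by (auto simp: topspace_model_top)
  show "continuous_map ?X ?X (inc \<circ> ret)"
    unfolding continuous_map_def
  proof (intro conjI allI impI funcsetI)
    show "(inc \<circ> ret) t \<in> topspace ?X" if "t \<in> topspace ?X" for t
      using that mhom_D(1)[OF mhom_ret] mhom_D(1)[OF mhom_inc] by (simp add: topspace_model_top)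
    fix V assume V: "openin ?X V"
    show "openin ?X {t \<in> topspace ?X. (inc \<circ> ret) t \<in> V}"
      unfolding openin_model_top
    proof (intro conjI allI impI)
      show "{t \<in> topspace ?X. (inc \<circ> ret) t \<in> V} \<subseteq> P \<times> carr (dual Q)"
        by (auto simp: topspace_model_top dsum_def)
      fix u \<phi> assume "(u, \<phi>) \<in> {t \<in> topspace ?X. (inc \<circ> ret) t \<in> V}"
      then have u: "u \<in> P" "\<phi> \<in> carr (dual Q)" and iV: "inc (ret (u, \<phi>)) \<in> V"
        by (auto simp: topspace_model_top Tc)
      obtain u' \<phi>' where i: "inc (ret (u, \<phi>)) = (u', \<phi>')" by (cases "inc (ret (u, \<phi>))")
      with iV have "(u', \<phi>') \<in> V" by simp
      from V[unfolded openin_model_top, THEN conjunct2, rule_format, OF this] obtain F where F: "finite F" "F \<subseteq> carr Q"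
        "\<forall>\<psi>\<in>carr (dual Q). (\<forall>x\<in>F. \<psi> x = \<phi>' x) \<longrightarrow> (u', \<psi>) \<in> V"
        by (elim exE conjE)
      \<comment> \<open>The vectors in \<open>F\<close> have finite support, so they see only
        coefficients at positions up to some \<open>N\<close>.\<close>
      have "finite (\<Union>x\<in>F. {i. x i \<noteq> 0})" "(\<Union>x\<in>F. {i. x i \<noteq> 0}) \<subseteq> Ind"
        using F(1,2) by (auto simp: free_rmod_def)
      from finite_subset_image[OF this(1) this(2)[unfolded Ind_def]]
      obtain B where B: "finite B" "B \<subseteq> UNIV \<times> S" "(\<Union>x\<in>F. {i. x i \<noteq> 0}) = (\<lambda>(k, j). enc k j) ` B"
        by (elim exE conjE)
      obtain N where N: "\<forall>n\<in>fst ` B. n \<le> N"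
        using finite_imageI[OF B(1), of fst] unfolding finite_nat_set_iff_bounded_le ..
      \<comment> \<open>Positions up to \<open>N\<close> of \<open>data\<close> involve entries up
        to \<open>N + 1\<close> of the sequence, and these depend on coordinates up to
        \<open>2 * (N + 1) + 5\<close>.\<close>
      let ?F = "(\<lambda>(n, j). delta (enc n j)) ` ({..2 * N + 7} \<times> S)"
      show "\<exists>F. finite F \<and> F \<subseteq> carr Q \<and> (\<forall>\<psi>\<in>carr (dual Q).
          (\<forall>x\<in>F. \<psi> x = \<phi> x) \<longrightarrow> (u, \<psi>) \<in> {t \<in> topspace ?X. (inc \<circ> ret) t \<in> V})"
      proof (intro exI[of _ ?F] conjI ballI impI)
        show "finite ?F" using finS by simp
        show "?F \<subseteq> carr Q" using delta_Q by auto
        fix \<psi> assume \<psi>: "\<psi> \<in> carr (dual Q)" "\<forall>x\<in>?F. \<psi> x = \<phi> x"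
        have co: "coord n \<psi> = coord n \<phi>" if "n \<le> 2 * N + 7" for n
          using \<psi>(2) that by (auto simp: coord_def)
        have dec: "decode k (ret (u, \<psi>)) = decode k (ret (u, \<phi>))" if "k \<le> N + 1" for k
          by (rule ret_finite_dependence) (use u co that in auto)
        define d where "d = data (\<lambda>k. decode k (ret (u, \<phi>)))"
        define d' where "d' = data (\<lambda>k. decode k (ret (u, \<psi>)))"
        have dd: "d' n = d n" if "n \<le> N" for n
          using dec[of "n div 2"] dec[of "Suc (n div 2)"] that
          by (simp add: d_def d'_def data_def boundary_def)
        have \<phi>': "\<phi>' = functional d" and u': "u' = eps (decode 0 (ret (u, \<phi>)))"
          using i by (simp_all add: inc_def d_def)
        have i': "inc (ret (u, \<psi>)) = (u', functional d')"
          using dec[of 0] by (simp add: inc_def d'_def u')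
        have "functional d' x = \<phi>' x" if x: "x \<in> F" for x
        proof -
          have "encode d' j = encode d j" if j: "x j \<noteq> 0" for j
          proof -
            have "j \<in> (\<lambda>(k, j). enc k j) ` B" using j x B(3) by blast
            then obtain k l where kl: "(k, l) \<in> B" "j = enc k l" by auto
            then have "k \<le> N" "l \<in> J" using N B(2) SJ by force+
            then show ?thesis using kl(2) dd by (simp add: encode_enc)
          qed
          then show ?thesis using x F(2) by (auto simp: \<phi>' functional_def intro: sum.cong)
        qed
        then have "inc (ret (u, \<psi>)) \<in> V" using F(3) functional_dual i' by simp
        then show "(u, \<psi>) \<in> {t \<in> topspace ?X. (inc \<circ> ret) t \<in> V}"
          using u(1) \<psi>(1) by (simp add: topspace_model_top Tc)
      qed
    qed
  qed
qed

lemma tate_Mod: "tate TYPE('i \<Rightarrow> 'r) TYPE('i \<Rightarrow> 'r) Mod mod_top"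
  unfolding tate_def
  by (intro conjI lmodule_Mod topspace_mod_top, rule exI[of _ "free_lmod J"], rule exI[of _ Q],
      rule exI[of _ inc], rule exI[of _ ret])
    (use continuous_inc continuous_ret in
      \<open>simp_all add: lprojective_free_lmod rprojective_free_rmod mhom_inc mhom_ret ret_inc model_top_def\<close>)

text \<open>The first factor is discrete, so every condition on the first component of
  \<open>inc\<close> is open.\<close>

lemma openin_inc_fst:
  "openin mod_top {m \<in> carr Mod. fst (inc m) \<in> A}"
proof -
  have "openin (model_top (free_lmod J) Q) ((A \<inter> P) \<times> carr (dual Q))"
    unfolding openin_model_top by auto
  from openin_continuous_map_preimage[OF continuous_inc this]
  show ?thesis
  proof (rule back_subst[of "openin mod_top"], intro Collect_cong)
    fix m
    show "(m \<in> topspace mod_top \<and> inc m \<in> (A \<inter> P) \<times> carr (dual Q)) = (m \<in> carr Mod \<and> fst (inc m) \<in> A)"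
      using mhom_D(1)[OF mhom_inc, of m] by (auto simp: topspace_mod_top dsum_def mem_Times_iff)
  qed
qed

section \<open>A lattice in the module of sequences\<close>

definition Lat :: "('i \<Rightarrow> 'r) set" where
  "Lat = ret ` (C \<times> carr (dual Q))"

lemma submodule_C: "submodule (C \<times> carr (dual Q)) T"
proof -
  note D = lmodule_D[OF lmodule_dual[OF rmodule_Q]]
  show ?thesis
    unfolding submodule_def
  proof (intro conjI ballI allI subsetI)
    fix x assume "x \<in> C \<times> carr (dual Q)"
    then obtain a \<phi> where x: "x = (a, \<phi>)" "a \<in> C" "\<phi> \<in> carr (dual Q)" by auto
    show "x \<in> carr T" using x C_P by (simp add: dsum_def)
    show "smul T r x \<in> C \<times> carr (dual Q)" for r
      using x D(6)[OF x(3)] C_closed(3)[OF x(2)] by (simp add: dsum_def free_lmod_simps del: dual_simps)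
    fix y assume "y \<in> C \<times> carr (dual Q)"
    then obtain b \<psi> where y: "y = (b, \<psi>)" "b \<in> C" "\<psi> \<in> carr (dual Q)" by auto
    show "add T x y \<in> C \<times> carr (dual Q)"
      using x y D(2)[OF x(3) y(3)] C_closed(1)[OF x(2) y(2)] by (simp add: dsum_def free_lmod_simps del: dual_simps)
  next
    show "zer T \<in> C \<times> carr (dual Q)"
      using D(1) zero_in_free_lmod by (simp add: dsum_def free_lmod_simps del: dual_simps)
  qed
qed

text \<open>\<open>Lat\<close> is a submodule containing every element whose first component under
  \<open>inc\<close> vanishes, so membership depends only on that component and
  \<open>openin_inc_fst\<close> applies.\<close>

lemma openin_Lat: "openin mod_top Lat"
proof -
  have sub: "submodule Lat Mod"
    unfolding Lat_def by (rule submodule_image[OF lmodule_T lmodule_Mod mhom_ret submodule_C])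
  have "Lat = {m \<in> carr Mod. fst (inc m) \<in> (\<lambda>m. fst (inc m)) ` Lat}"
  proof (intro equalityI subsetI)
    fix m assume "m \<in> Lat" then show "m \<in> {m \<in> carr Mod. fst (inc m) \<in> (\<lambda>m. fst (inc m)) ` Lat}"
      using submodule_D(1)[OF sub] by simp
  next
    fix m assume "m \<in> {m \<in> carr Mod. fst (inc m) \<in> (\<lambda>m. fst (inc m)) ` Lat}"
    then obtain l where m: "m \<in> carr Mod" and l: "l \<in> Lat" "fst (inc m) = fst (inc l)" by auto
    have lM: "l \<in> carr Mod" by (rule submodule_D(1)[OF sub l(1)])
    \<comment> \<open>Its first component is zero and so lies in \<open>C\<close>; hence
      \<open>ret (inc ?d)\<close>, which is \<open>?d\<close> itself, belongs to
      \<open>Lat\<close>.\<close>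
    let ?d = "m + fscale (- 1) l"
    have dM: "?d \<in> carr Mod" by (rule Mod_closed(1)[OF m Mod_closed(2)[OF lM]])
    have "inc ?d = add T (inc m) (smul T (- 1) (inc l))"
      using mhom_D(2)[OF mhom_inc m, of "fscale (- 1) l"] mhom_D(3)[OF mhom_inc lM, of "- 1"] Mod_closed(2)[OF lM]
      by simp
    then have "fst (inc ?d) = 0"
      using l(2) by (simp add: dsum_def case_prod_unfold free_lmod_simps fscale_simps)
    moreover have "inc ?d \<in> carr T" by (rule mhom_D(1)[OF mhom_inc dM])
    ultimately have "inc ?d \<in> C \<times> carr (dual Q)"
      by (cases "inc ?d") (auto simp: dsum_def zero_in_free_lmod)
    then have "ret (inc ?d) \<in> Lat" unfolding Lat_def by (rule imageI)
    then have "?d \<in> Lat" using ret_inc[OF dM] by simp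
    then have "add Mod ?d l \<in> Lat" using submodule_D(3)[OF sub] l(1) by blast
    then show "m \<in> Lat" by (simp add: fscale_simps)
  qed
  then show ?thesis using openin_inc_fst[of "(\<lambda>m. fst (inc m)) ` Lat"] by simp
qed

text \<open>\<open>C\<close> is generated by finitely many basis vectors, and the dual of
  \<open>Q\<close> is finitely generated modulo functionals vanishing on a finite set. Both
  properties pass to the image under the continuous map \<open>ret\<close>.\<close>

lemma lattice_Lat: "lattice_in Mod mod_top Lat"
  unfolding lattice_in_def
proof (intro conjI allI impI openin_Lat)
  show sub: "submodule Lat Mod"
    unfolding Lat_def by (rule submodule_image[OF lmodule_T lmodule_Mod mhom_ret submodule_C])
  fix U assume U: "submodule U Mod \<and> openin mod_top U \<and> U \<subseteq> Lat"
  have rQ: "rprojective Q" by (rule rprojective_free_rmod)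
  note lD = lmodule_dual[OF rmodule_Q]
  \<comment> \<open>A basic neighbourhood of zero in the preimage of \<open>U\<close>: functionals
    vanishing on a finite \<open>F\<close> are sent into \<open>U\<close>.\<close>
  have "openin (model_top (free_lmod J) Q) {t \<in> topspace (model_top (free_lmod J) Q). ret t \<in> U}"
    by (rule openin_continuous_map_preimage[OF continuous_ret]) (use U in simp)
  note o = this[unfolded openin_model_top, THEN conjunct2, rule_format]
  have "zer T \<in> carr T" "ret (zer T) \<in> U"
    using lmodule_D(1)[OF lmodule_T] mhom_zer[OF lmodule_T lmodule_Mod mhom_ret] U
    by (auto simp: submodule_def)
  then have "(0, zer (dual Q)) \<in> {t \<in> topspace (model_top (free_lmod J) Q). ret t \<in> U}"
    by (simp add: topspace_model_top) (simp add: dsum_def free_lmod_simps)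
  from o[OF this] obtain F where F: "finite F" "F \<subseteq> carr Q"
    "\<forall>\<psi>\<in>carr (dual Q). (\<forall>x\<in>F. \<psi> x = zer (dual Q) x) \<longrightarrow> (0, \<psi>) \<in> {t \<in> topspace (model_top (free_lmod J) Q). ret t \<in> U}"
    by (elim exE conjE)
  have FU: "ret (0, \<psi>) \<in> U" if "\<psi> \<in> carr (dual Q)" "\<forall>x\<in>F. \<psi> x = 0" for \<psi>
  proof -
    have "zer (dual Q) x = 0" if "x \<in> F" for x using F(2) that by auto
    then show ?thesis using F(3) that by simp
  qed
  from dual_fin_gen_mod_open[OF rQ F(1,2)] obtain \<Xi> where \<Xi>: "finite \<Xi>" "\<Xi> \<subseteq> carr (dual Q)"
    "\<forall>Y. submodule Y (dual Q) \<and> \<Xi> \<subseteq> Y \<and> {\<psi> \<in> carr (dual Q). \<forall>x\<in>F. \<psi> x = 0} \<subseteq> Y \<longrightarrow> carr (dual Q) \<subseteq> Y"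
    by (elim exE conjE)
  have dS: "delta s \<in> C" if "s \<in> S" for s using that by (simp add: free_lmod_gfree)
  let ?z = "zer (dual Q)"
  let ?G = "ret ` ((\<lambda>s. (delta s, ?z)) ` S \<union> (\<lambda>\<xi>. (0, \<xi>)) ` \<Xi>)"
  have G: "?G \<subseteq> Lat"
    unfolding Lat_def using dS lmodule_D(1)[OF lD] zero_in_free_lmod[of S] \<Xi>(2) by (intro image_mono) auto
  have "span Mod (?G \<union> U) = Lat"
  proof (rule antisym)
    show "span Mod (?G \<union> U) \<subseteq> Lat" by (rule span_subset[OF sub]) (use G U in blast)
    show "Lat \<subseteq> span Mod (?G \<union> U)"
      unfolding span_def
    proof (intro subsetI InterI, elim CollectE conjE)
      fix m Y assume m: "m \<in> Lat" and Y: "submodule Y Mod" "?G \<union> U \<subseteq> Y"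
      obtain c \<phi> where c: "c \<in> C" and \<phi>: "\<phi> \<in> carr (dual Q)" and mc: "m = ret (c, \<phi>)"
        using m by (auto simp: Lat_def)
      \<comment> \<open>Pulling \<open>Y\<close> back along the two coordinate inclusions reduces
        the claim to \<open>C\<close> and to the dual separately.\<close>
      have h1: "mhom (free_lmod S) T (\<lambda>c. (c, ?z))"
        using lmodule_D(1)[OF lD] lmodule_D(5)[OF lD lmodule_D(1)[OF lD]] smul_zer[OF lD] C_P
        by (simp add: mhom_def dsum_def free_lmod_simps del: dual_simps)
      have h2: "mhom (dual Q) T (\<lambda>\<phi>. (0, \<phi>))"
        by (simp add: mhom_def dsum_def free_lmod_simps fscale_simps zero_in_free_lmod del: dual_simps)
      have s1: "submodule {c \<in> C. ret (c, ?z) \<in> Y} (free_lmod S)"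
        by (rule submodule_vimage[OF lmodule_free_lmod lmodule_Mod mhom_comp[OF h1 mhom_ret] Y(1)])
      have "ret (c, ?z) \<in> Y"
      proof -
        have "c \<in> {c \<in> C. ret (c, ?z) \<in> Y}"
        proof (rule gfree_induct[OF ring_or_opp_mult(1), of c S])
          show "c \<in> carr (gfree (*) S)" using c by (simp add: free_lmod_gfree)
          show "(\<lambda>i. 0) \<in> {c \<in> C. ret (c, ?z) \<in> Y}"
            using submodule_D(2)[OF s1] by (simp only: free_lmod_simps zero_fun_def)
          fix i r assume "i \<in> S"
          then have "delta i \<in> {c \<in> C. ret (c, ?z) \<in> Y}" using Y(2) dS by auto
          then show "smul (gfree (*) S) r (delta i) \<in> {c \<in> C. ret (c, ?z) \<in> Y}"
            using submodule_D(4)[OF s1] by (simp only: free_lmod_gfree)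
        next
          fix y z assume "y \<in> {c \<in> C. ret (c, ?z) \<in> Y}" "z \<in> {c \<in> C. ret (c, ?z) \<in> Y}"
          then show "add (gfree (*) S) y z \<in> {c \<in> C. ret (c, ?z) \<in> Y}"
            using submodule_D(3)[OF s1] by (simp only: free_lmod_gfree)
        qed
        then show ?thesis by simp
      qed
      moreover have "ret (0, \<phi>) \<in> Y"
      proof -
        have "submodule {\<phi> \<in> carr (dual Q). ret (0, \<phi>) \<in> Y} (dual Q)"
          by (rule submodule_vimage[OF lD lmodule_Mod mhom_comp[OF h2 mhom_ret] Y(1)])
        moreover have "\<Xi> \<subseteq> {\<phi> \<in> carr (dual Q). ret (0, \<phi>) \<in> Y}" using \<Xi>(2) Y(2) by auto
        moreover have "{\<psi> \<in> carr (dual Q). \<forall>x\<in>F. \<psi> x = 0} \<subseteq> {\<phi> \<in> carr (dual Q). ret (0, \<phi>) \<in> Y}"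
          using FU Y(2) by blast
        ultimately have "carr (dual Q) \<subseteq> {\<phi> \<in> carr (dual Q). ret (0, \<phi>) \<in> Y}"
          by (intro \<Xi>(3)[rule_format] conjI)
        then show ?thesis using \<phi> by blast
      qed
      ultimately have "add Mod (ret (c, ?z)) (ret (0, \<phi>)) \<in> Y" by (rule submodule_D(3)[OF Y(1)])
      also have "add Mod (ret (c, ?z)) (ret (0, \<phi>)) = ret (add T (c, ?z) (0, \<phi>))"
        by (rule mhom_D(2)[OF mhom_ret, symmetric])
          (use c \<phi> C_P zero_in_free_lmod lmodule_D(1)[OF lD] in \<open>auto simp: dsum_def simp del: dual_simps\<close>)
      also have "add T (c, ?z) (0, \<phi>) = (c, \<phi>)"
        using lmodule_D(5)[OF lD \<phi>] by (simp add: dsum_def free_lmod_simps del: dual_simps)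
      finally show "m \<in> Y" using mc by simp
    qed
  qed
  then show "\<exists>G. finite G \<and> G \<subseteq> Lat \<and> span Mod (G \<union> U) = Lat"
    using G \<Xi>(1) finS by (intro exI[of _ ?G]) simp
qed

section \<open>The quotient map onto \<open>M0\<close> and its kernel\<close>

definition Ker :: "('i \<Rightarrow> 'r) set" where
  "Ker = {m \<in> carr Mod. q (decode 0 m) = zer M0}"

lemma mhom_q_decode: "mhom Mod M0 (\<lambda>m. q (decode 0 m))"
  by (rule mhom_comp[OF _ q(1)]) (simp add: mhom_def decode_P decode_linear free_lmod_simps)

lemma quotient_Mod: "quotient_rep Mod Ker M0"
  unfolding quotient_rep_def
proof (intro exI[of _ "\<lambda>m. q (decode 0 m)"] conjI mhom_q_decode)
  show "(\<lambda>m. q (decode 0 m)) ` carr Mod = carr M0"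
  proof (intro equalityI subsetI)
    fix y assume "y \<in> carr M0"
    then obtain z where z: "z \<in> P" "y = q z" using q(2) by blast
    \<comment> \<open>The sequence starts with \<open>eps z\<close> instead of \<open>z\<close>:
      then its boundary at \<open>0\<close> is \<open>defect z\<close>, which lies in
      \<open>C\<close>, and \<open>q\<close> still gives \<open>y\<close>. All later boundaries
      vanish.\<close>
    define x where "x k = (if k = 0 then eps z else 0)" for k :: nat
    have xP: "x k \<in> P" for k using z(1) eps_P by (simp add: x_def zero_in_free_lmod)
    have "boundary x k \<in> C" for k
      using defect_C[OF z(1)]
      by (simp add: boundary_def x_def eps_zero defect_def zero_in_free_lmod)
    then have "encode x \<in> carr Mod"
      using xP by (simp add: Mod_def encode_outside decode_encode[of x] admissible_def)
    moreover have "q (decode 0 (encode x)) = y"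
      using decode_encode[of x 0, OF xP] z q_eps by (simp add: x_def)
    ultimately show "y \<in> (\<lambda>m. q (decode 0 m)) ` carr Mod" by force
  qed (use mhom_D(1)[OF mhom_q_decode] in auto)
qed (simp add: Ker_def)

lemma Ker_props: "submodule Ker Mod" "openin mod_top Ker" "bounded_in Mod mod_top Ker"
proof -
  show "submodule Ker Mod"
    using submodule_vimage[OF lmodule_Mod M0 mhom_q_decode submodule_zer[OF M0]] by (simp add: Ker_def)
  \<comment> \<open>Since \<open>q\<close> is unchanged by \<open>eps\<close>, the value of
    \<open>q\<close> on entry \<open>0\<close> is read off from the discrete component of
    \<open>inc\<close>.\<close>
  have "Ker = {m \<in> carr Mod. fst (inc m) \<in> {u. q u = zer M0}}"
    using q_eps decode_P by (auto simp: Ker_def inc_def)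
  then show "openin mod_top Ker" using openin_inc_fst[of "{u. q u = zer M0}"] by simp
  have "Ker \<subseteq> Lat"
  proof
    fix m assume "m \<in> Ker"
    then have m: "m \<in> carr Mod" "q (decode 0 m) = zer M0" by (auto simp: Ker_def)
    \<comment> \<open>On the kernel the discrete component lies in \<open>C\<close> as well, by
      \<open>eps_ker\<close>.\<close>
    have "inc m \<in> C \<times> carr (dual Q)"
      using eps_ker[OF decode_P[OF m(1)] m(2)] functional_dual by (simp add: inc_def)
    then have "ret (inc m) \<in> Lat" unfolding Lat_def by (rule imageI)
    then show "m \<in> Lat" using ret_inc[OF m(1)] by simp
  qed
  then show "bounded_in Mod mod_top Ker" unfolding bounded_in_def using lattice_Lat by blast
qed

end

section \<open>Lifting the idempotent of an almost projective module\<close>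

text \<open>A free module maps by \<pi> onto a sum of a free module and \<open>F\<close> with kernel
  inside the finitely generated part on \<open>S\<close>. Lifting through \<pi> the idempotent whose
  image is \<open>M0\<close> gives \<open>eps\<close>, and \<alpha> moves the basis into the type
  \<open>'i\<close>.\<close>

lemma almost_projective_split:
  fixes M0 :: "('r::ring_1, 'a) lmod" and \<alpha> :: "'p + 'f \<Rightarrow> 'i"
  assumes ap: "almost_projective TYPE('p) TYPE('f) M0" and inj: "inj \<alpha>"
  shows "\<exists>J S eps q. finite S \<and> S \<subseteq> J \<and> J \<subseteq> range \<alpha> \<and>
    mhom (free_lmod J) (free_lmod J :: ('r, 'i \<Rightarrow> 'r) lmod) eps \<and>
    mhom (free_lmod J) M0 q \<and> q ` carr (free_lmod J) = carr M0 \<and>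
    (\<forall>x\<in>carr (free_lmod J). q (eps x) = q x) \<and>
    (\<forall>x\<in>carr (free_lmod J). q x = zer M0 \<longrightarrow> eps x \<in> carr (free_lmod S))"
proof -
  obtain P0 :: "('r, 'p) lmod" and F :: "('r, 'f) lmod" where
    M0: "lmodule M0" and P0: "lprojective P0" and lF: "lmodule F" and fg: "fin_gen F"
    and sm: "summand M0 (dsum P0 F)"
    using ap unfolding almost_projective_def by blast
  obtain G where G: "finite G" "G \<subseteq> carr F" "span F G = carr F"
    using fg unfolding fin_gen_def by blast
  obtain i p where ip: "mhom M0 (dsum P0 F) i" "mhom (dsum P0 F) M0 p" "\<forall>x\<in>carr M0. p (i x) = x"
    using sm unfolding summand_def by blast
  obtain iP pP where iP: "mhom P0 (free_lmod (carr P0)) iP" and pP: "mhom (free_lmod (carr P0)) P0 pP"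
    and pi: "\<forall>x\<in>carr P0. pP (iP x) = x"
    using P0 unfolding lprojective_def summand_def by blast
  \<comment> \<open>Replacing \<open>P0\<close> by the free module of which it is a summand keeps
    \<open>M0\<close> a summand.\<close>
  let ?X = "dsum (free_lmod (carr P0)) F"
  have lX: "lmodule ?X" by (rule lmodule_dsum[OF lmodule_free_lmod lF])
  have "mhom (dsum P0 F) ?X (\<lambda>(u, v). (iP u, v))"
    using mhom_D[OF iP] by (auto simp: mhom_def dsum_def)
  from mhom_comp[OF ip(1) this] have i': "mhom M0 ?X (\<lambda>m. case i m of (u, v) \<Rightarrow> (iP u, v))" .
  have "mhom ?X (dsum P0 F) (\<lambda>(a, v). (pP a, v))"
    using mhom_D[OF pP] by (auto simp: mhom_def dsum_def)
  from mhom_comp[OF this ip(2)] have p': "mhom ?X M0 (\<lambda>t. p (case t of (a, v) \<Rightarrow> (pP a, v)))" .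
  define i' where "i' m = (case i m of (u, v) \<Rightarrow> (iP u, v))" for m
  define p' where "p' t = p (case t of (a, v) \<Rightarrow> (pP a, v))" for t
  note i' = i'[folded i'_def] and p' = p'[folded p'_def]
  have p'i': "p' (i' m) = m" if m: "m \<in> carr M0" for m
  proof -
    obtain u v where uv: "i m = (u, v)" by (cases "i m")
    then have "u \<in> carr P0" using mhom_D(1)[OF ip(1) m] by (simp add: dsum_def)
    then show ?thesis using pi bspec[OF ip(3) m] uv by (simp add: i'_def p'_def)
  qed
  \<comment> \<open>One basis vector for each element of \<open>carr P0\<close> and one for each
    chosen generator of \<open>F\<close>.\<close>
  define J where "J = \<alpha> ` (Inl ` carr P0 \<union> Inr ` G)"
  define S where "S = \<alpha> ` Inr ` G"
  have SJ: "finite S" "S \<subseteq> J" "J \<subseteq> range \<alpha>" using G(1) by (auto simp: S_def J_def)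
  define g where "g j = (case inv_into UNIV \<alpha> j of Inl x \<Rightarrow> zer F | Inr y \<Rightarrow> y)" for j
  have gJ: "g j \<in> carr F" if "j \<in> J" for j
    using that lmodule_D(1)[OF lF] G(2) inj by (auto simp: J_def g_def)
  have "\<exists>f. mhom (gfree (*) J) F f \<and> (\<forall>j\<in>J. f (delta j) = g j)"
    by (rule gfree_universal) (use gJ lF in \<open>simp_all add: lmodule_gmodule\<close>)
  then obtain h where h: "mhom (free_lmod J) F h" "\<forall>j\<in>J. h (delta j) = g j"
    unfolding free_lmod_gfree by blast
  define \<pi> where "\<pi> z = ((\<lambda>x. if x \<in> carr P0 then z (\<alpha> (Inl x)) else 0), h z)" for z :: "'i \<Rightarrow> 'r"
  have fin: "finite {x. x \<in> carr P0 \<and> z (\<alpha> (Inl x)) \<noteq> 0}" if "finite {j. z j \<noteq> 0}" for z :: "'i \<Rightarrow> 'r"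
  proof (rule finite_imageD)
    show "finite ((\<lambda>x. \<alpha> (Inl x)) ` {x. x \<in> carr P0 \<and> z (\<alpha> (Inl x)) \<noteq> 0})"
      by (rule finite_subset[OF _ that]) auto
    show "inj_on (\<lambda>x. \<alpha> (Inl x)) {x. x \<in> carr P0 \<and> z (\<alpha> (Inl x)) \<noteq> 0}"
      using inj by (auto simp: inj_on_def)
  qed
  have \<pi>1: "(\<lambda>x. if x \<in> carr P0 then z (\<alpha> (Inl x)) else 0) \<in> carr (free_lmod (carr P0))"
    if "z \<in> carr (free_lmod J)" for z :: "'i \<Rightarrow> 'r"
  proof -
    have "finite {j. z j \<noteq> 0}" using that by (simp add: free_lmod_def)
    from fin[OF this] show ?thesis
      by (simp add: free_lmod_def) (rule finite_subset[rotated], auto)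
  qed
  have "mhom (free_lmod J) (free_lmod (carr P0)) (\<lambda>(z :: 'i \<Rightarrow> 'r) x. if x \<in> carr P0 then z (\<alpha> (Inl x)) else 0)"
    unfolding mhom_def
    by (intro conjI ballI allI) (auto intro: \<pi>1 simp: free_lmod_simps fscale_def)
  then have \<pi>: "mhom (free_lmod J) ?X \<pi>"
    using h(1) by (simp add: mhom_def dsum_def \<pi>_def)
  \<comment> \<open>The first component of \<pi> reads off all coordinates in \<open>J\<close>
    outside \<open>S\<close>.\<close>
  have kerC: "z \<in> carr (free_lmod S)" if z: "z \<in> carr (free_lmod J)" "\<pi> z = zer ?X" for z
  proof -
    have "z (\<alpha> (Inl x)) = 0" if "x \<in> carr P0" for x
      using fun_cong[OF arg_cong[OF z(2), of fst], of x] that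
      by (simp add: \<pi>_def dsum_def free_lmod_def)
    then have "z j = 0" if "j \<notin> S" for j
      using that z(1) by (cases "j \<in> J") (auto simp: free_lmod_def J_def S_def)
    then show ?thesis using z(1) by (simp add: free_lmod_def)
  qed
  have hC: "carr F \<subseteq> h ` carr (free_lmod S)"
  proof -
    have "mhom (free_lmod S) F h"
      using h(1) by (simp add: mhom_def free_lmod_simps free_lmod_mono[OF SJ(2)])
    moreover have "submodule (carr (free_lmod S)) (free_lmod S :: ('r, 'i \<Rightarrow> 'r) lmod)"
      by (simp add: submodule_def lmodule_D(1,2,6)[OF lmodule_free_lmod])
    ultimately have "submodule (h ` carr (free_lmod S)) F"
      by (intro submodule_image[OF lmodule_free_lmod lF])
    moreover have "G \<subseteq> h ` carr (free_lmod S)"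
    proof
      fix y assume y: "y \<in> G"
      then have s: "\<alpha> (Inr y) \<in> S" by (simp add: S_def)
      have "h (delta (\<alpha> (Inr y))) = y" using h(2) s SJ(2) inj by (auto simp: g_def)
      moreover have "delta (\<alpha> (Inr y)) \<in> carr (free_lmod S)" using s by (simp add: free_lmod_gfree)
      ultimately show "y \<in> h ` carr (free_lmod S)" by (metis imageI)
    qed
    ultimately show ?thesis using span_subset G(3) by metis
  qed
  have \<pi>s: "carr ?X \<subseteq> \<pi> ` carr (free_lmod J)"
  proof
    fix t assume "t \<in> carr ?X"
    then obtain a v where t: "t = (a, v)" "a \<in> carr (free_lmod (carr P0))" "v \<in> carr F"
      by (auto simp: dsum_def)
    \<comment> \<open>\<open>z\<close> realizes the first component \<open>a\<close>. Adding an
      element of the free module on \<open>S\<close> leaves that component unchanged and, by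
      \<open>hC\<close>, adjusts the second one to \<open>v\<close>.\<close>
    define z where "z = (\<lambda>j. if j \<in> range \<alpha> then case inv_into UNIV \<alpha> j of Inl x \<Rightarrow> a x | Inr y \<Rightarrow> 0 else 0)"
    have zl: "z (\<alpha> (Inl x)) = a x" for x using inj by (simp add: z_def)
    have "{j. z j \<noteq> 0} \<subseteq> (\<lambda>x. \<alpha> (Inl x)) ` {x. a x \<noteq> 0}"
    proof
      fix j assume "j \<in> {j. z j \<noteq> 0}"
      then have j: "z j \<noteq> 0" "j \<in> range \<alpha>" by (auto simp: z_def split: if_splits)
      then obtain b where b: "j = \<alpha> b" by blast
      show "j \<in> (\<lambda>x. \<alpha> (Inl x)) ` {x. a x \<noteq> 0}"
        using j(1) inj by (cases b) (auto simp: z_def b)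
    qed
    moreover have "{x. a x \<noteq> 0} \<subseteq> carr P0" "finite {x. a x \<noteq> 0}" using t(2) by (auto simp: free_lmod_def)
    ultimately have zf: "finite {j. z j \<noteq> 0}" "{j. z j \<noteq> 0} \<subseteq> J"
      unfolding J_def by (blast intro: finite_subset)+
    then have zJ: "z \<in> carr (free_lmod J)" by (auto simp: free_lmod_def)
    have hz: "h z \<in> carr F" by (rule mhom_D(1)[OF h(1) zJ])
    have nz: "smul F (- 1) (h z) \<in> carr F" by (rule lmodule_D(6)[OF lF hz])
    have "add F v (smul F (- 1) (h z)) \<in> h ` carr (free_lmod S)"
      using hC lmodule_D(2)[OF lF t(3) nz] by blast
    then obtain c where c: "c \<in> carr (free_lmod S)" "h c = add F v (smul F (- 1) (h z))" by auto
    have cJ: "c \<in> carr (free_lmod J)" by (rule free_lmod_mono[OF SJ(2) c(1)])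
    have "h (c + z) = add F (add F v (smul F (- 1) (h z))) (h z)"
      using mhom_D(2)[OF h(1) cJ zJ] c(2) by (simp add: free_lmod_simps)
    also have "\<dots> = add F v (add F (smul F (- 1) (h z)) (h z))"
      by (rule lmodule_D(3)[OF lF t(3) nz hz])
    also have "\<dots> = v"
      using add_neg[OF lF hz] lmodule_D(4)[OF lF nz hz] add_zer_right[OF lF t(3)] by simp
    finally have hv: "h (c + z) = v" .
    have "c (\<alpha> (Inl x)) = 0" for x
    proof -
      have "\<alpha> (Inl x) \<notin> S" using inj by (auto simp: S_def dest: injD)
      then show ?thesis using c(1) by (simp add: free_lmod_def)
    qed
    then have "\<pi> (c + z) = t"
      using t(1,2) hv zl by (auto simp: \<pi>_def free_lmod_def fun_eq_iff)
    moreover have "c + z \<in> carr (free_lmod J)" by (rule free_lmod_closed(1)[OF cJ zJ])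
    ultimately show "t \<in> \<pi> ` carr (free_lmod J)" by blast
  qed
  define q where "q z = p' (\<pi> z)" for z
  have q: "mhom (free_lmod J) M0 q" unfolding q_def by (rule mhom_comp[OF \<pi> p'])
  \<comment> \<open>Here \<open>\<pi> \<circ> eps\<close> equals
    \<open>i' \<circ> p' \<circ> \<pi>\<close>. Applying \<open>p'\<close> gives
    \<open>q \<circ> eps = q\<close>, and where \<open>q\<close> vanishes \<open>eps\<close> lands
    in the kernel of \<pi>.\<close>
  obtain eps where eps: "mhom (free_lmod J) (free_lmod J) eps"
    "\<forall>x\<in>carr (free_lmod J). \<pi> (eps x) = i' (q x)"
    using free_lmod_lift[OF lX lmodule_free_lmod mhom_comp[OF q i'] \<pi> \<pi>s] by blast
  have "carr M0 \<subseteq> q ` carr (free_lmod J)"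
  proof
    fix m assume m: "m \<in> carr M0"
    obtain z where "z \<in> carr (free_lmod J)" "\<pi> z = i' m"
      using \<pi>s mhom_D(1)[OF i' m] by (auto simp: image_iff)
    then show "m \<in> q ` carr (free_lmod J)" using p'i'[OF m] by (auto simp: q_def intro!: image_eqI[of _ _ z])
  qed
  then have qs: "q ` carr (free_lmod J) = carr M0" using mhom_D(1)[OF q] by blast
  have "q (eps x) = q x" if "x \<in> carr (free_lmod J)" for x
    using eps(2) p'i'[OF mhom_D(1)[OF q that]] that by (simp add: q_def[of "eps x"])
  moreover have "eps x \<in> carr (free_lmod S)" if x: "x \<in> carr (free_lmod J)" "q x = zer M0" for x
    using kerC[OF mhom_D(1)[OF eps(1) x(1)]] eps(2) x mhom_zer[OF M0 lX i'] by simp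
  ultimately show ?thesis using SJ eps(1) q qs
    by (intro exI[of _ J] exI[of _ S] exI[of _ eps] exI[of _ q]) simp
qed

theorem theorem4p1:
  fixes M0 :: "('r::ring_1, 'a) lmod"
  shows
   "(almost_projective TYPE('p) TYPE('f) M0 \<longrightarrow>
      (\<exists>(M :: ('r, ('a + 'p + 'f + 'r + nat) set \<Rightarrow> 'r) lmod) \<tau> L.
         tate TYPE(('a + 'p + 'f + 'r + nat) set \<Rightarrow> 'r) TYPE(('a + 'p + 'f + 'r + nat) set \<Rightarrow> 'r) M \<tau> \<and>
         submodule L M \<and> openin \<tau> L \<and> bounded_in M \<tau> L \<and> quotient_rep M L M0))
    \<and>
    (almost_projective2 TYPE('p) TYPE('f) M0 \<longrightarrow>
      (\<forall>(M :: ('r, 'm) lmod) \<tau> L.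
         tate TYPE('p2) TYPE('q2) M \<tau> \<and>
         submodule L M \<and> openin \<tau> L \<and> bounded_in M \<tau> L \<and> quotient_rep M L M0
         \<longrightarrow> lattice_in M \<tau> L))"
proof (intro conjI impI allI)
  assume ap: "almost_projective TYPE('p) TYPE('f) M0"
  \<comment> \<open>Indices in \<open>J\<close> are singletons coming from \<open>'p\<close> or
    \<open>'f\<close>, and position \<open>k\<close> is coded by adjoining the natural number
    \<open>k\<close>; sets leave room for all pairs of a position and an index within one
    type.\<close>
  define \<alpha> :: "'p + 'f \<Rightarrow> ('a + 'p + 'f + 'r + nat) set" where
    "\<alpha> b = {case b of Inl x \<Rightarrow> Inr (Inl x) | Inr y \<Rightarrow> Inr (Inr (Inl y))}" for b
  define enc :: "nat \<Rightarrow> ('a + 'p + 'f + 'r + nat) set \<Rightarrow> ('a + 'p + 'f + 'r + nat) set" where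
    "enc k j = insert (Inr (Inr (Inr (Inr k)))) j" for k j
  have "inj \<alpha>" by (auto simp: inj_def \<alpha>_def split: sum.splits)
  from almost_projective_split[OF ap this] obtain J S eps q where
    split: "finite S" "S \<subseteq> J" "J \<subseteq> range \<alpha>"
      "mhom (free_lmod J) (free_lmod J :: ('r, _ \<Rightarrow> 'r) lmod) eps"
      "mhom (free_lmod J) M0 q" "q ` carr (free_lmod J) = carr M0"
      "\<forall>x\<in>carr (free_lmod J). q (eps x) = q x"
      "\<forall>x\<in>carr (free_lmod J). q x = zer M0 \<longrightarrow> eps x \<in> carr (free_lmod S)"
    by (elim exE conjE)
  \<comment> \<open>The marker of \<open>k\<close> occurs in no index of \<open>J\<close>, so it can
    be read off from \<open>enc k j\<close> and removed to recover \<open>j\<close>.\<close>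
  have nat: "Inr (Inr (Inr (Inr k))) \<notin> j" if "j \<in> J" for k j
    using split(3) that by (auto simp: \<alpha>_def split: sum.splits)
  have "inj_on (\<lambda>(k, j). enc k j) (UNIV \<times> J)"
  proof (rule inj_onI, clarify)
    fix k j k' j' assume jj: "j \<in> J" "j' \<in> J" "enc k j = enc k' j'"
    have "Inr (Inr (Inr (Inr k))) \<in> enc k' j'" unfolding jj(3)[symmetric] by (simp add: enc_def)
    then have "k = k'" using nat[OF jj(2), of k] by (simp add: enc_def)
    then show "k = k' \<and> j = j'" using nat[OF jj(1), of k] nat[OF jj(2), of k] jj(3)
      by (auto simp: enc_def insert_ident)
  qed
  then interpret almost_split J S eps q M0 enc
    using split ap by unfold_locales (auto simp: almost_projective_def)
  show "\<exists>(M :: ('r, ('a + 'p + 'f + 'r + nat) set \<Rightarrow> 'r) lmod) \<tau> L.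
         tate TYPE(('a + 'p + 'f + 'r + nat) set \<Rightarrow> 'r) TYPE(('a + 'p + 'f + 'r + nat) set \<Rightarrow> 'r) M \<tau> \<and>
         submodule L M \<and> openin \<tau> L \<and> bounded_in M \<tau> L \<and> quotient_rep M L M0"
    using tate_Mod Ker_props quotient_Mod by blast
next
  fix M :: "('r, 'm) lmod" and \<tau> L
  assume "almost_projective2 TYPE('p) TYPE('f) M0"
    and "tate TYPE('p2) TYPE('q2) M \<tau> \<and>
         submodule L M \<and> openin \<tau> L \<and> bounded_in M \<tau> L \<and> quotient_rep M L M0"
  then show "lattice_in M \<tau> L" using bounded_quotient_lattice by blast
qed

end
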